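(* For every integer $n \geq 1$ there is a real number $\alpha = \alpha(n) > 0$ such that the following holds. Let $\Sigma$ be a finite symmetric subset of $\operatorname{U}_n(\mathbb{C})$ and suppose that the subgroup $\langle \Sigma \rangle$ generated by $\Sigma$ is not virtually abelian. Then there is a constant $c = c_\Sigma > 0$ (which may depend on $\Sigma$) such that $|\Sigma^r| \geq 2^{c r^{\alpha}}$ for all integers $r \geq 1$.
   Context: $\operatorname{U}_n(\mathbb{C})$ is the group of $n \times n$ complex unitary matrices. A subset $\Sigma$ of a group is symmetric if $\sigma \in \Sigma$ implies $\sigma^{-1} \in \Sigma$. $\Sigma^r$ denotes the set of all products of $r$ elements of $\Sigma$. A group is virtually abelian if it has an abelian subgroup of finite index. *)

theory Defs
  imports
    "HOL-Algebra.Generated_Groups"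
    "Jordan_Normal_Form.Schur_Decomposition"
begin

definition unitary_group :: "nat \<Rightarrow> complex mat monoid" where
  "unitary_group n =
     \<lparr>carrier = {A \<in> carrier_mat n n. A * mat_adjoint A = 1\<^sub>m n \<and> mat_adjoint A * A = 1\<^sub>m n},
      monoid.mult = (*),
      one = 1\<^sub>m n\<rparr>"

definition symmetric_subset :: "('a, 'b) monoid_scheme \<Rightarrow> 'a set \<Rightarrow> bool" where
  "symmetric_subset G S \<longleftrightarrow> S \<subseteq> carrier G \<and> (\<forall>s\<in>S. inv\<^bsub>G\<^esub> s \<in> S)"

primrec product_set :: "('a, 'b) monoid_scheme \<Rightarrow> 'a set \<Rightarrow> nat \<Rightarrow> 'a set" where
  "product_set G S 0 = {\<one>\<^bsub>G\<^esub>}"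
| "product_set G S (Suc r) = product_set G S r <#>\<^bsub>G\<^esub> S"

definition virtually_abelian :: "('a, 'b) monoid_scheme \<Rightarrow> bool" where
  "virtually_abelian G \<longleftrightarrow>
     (\<exists>H. subgroup H G \<and> comm_group (G\<lparr>carrier := H\<rparr>) \<and> finite (rcosets\<^bsub>G\<^esub> H))"

lemma mat_adjoint_index:
  assumes "A \<in> carrier_mat n n" "i < n" "j < n"
  shows "mat_adjoint A $$ (i, j) = conjugate (A $$ (j, i))"
  using assms by (auto simp: mat_adjoint_def mat_of_rows_def)

lemma mat_adjoint_square_carrier:
  "A \<in> carrier_mat n n \<Longrightarrow> mat_adjoint A \<in> carrier_mat n n"
  by (auto simp: mat_adjoint_def)

lemma mat_adjoint_adjoint:
  assumes "(A :: complex mat) \<in> carrier_mat n n"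
  shows "mat_adjoint (mat_adjoint A) = A"
  using assms mat_adjoint_square_carrier[OF assms]
    mat_adjoint_square_carrier[OF mat_adjoint_square_carrier[OF assms]]
  by (intro eq_matI) (auto simp: mat_adjoint_index)

lemma mat_adjoint_mult:
  assumes A: "(A :: complex mat) \<in> carrier_mat n n" and B: "B \<in> carrier_mat n n"
  shows "mat_adjoint (A * B) = mat_adjoint B * mat_adjoint A"
proof (rule eq_matI)
  note carrs = mat_adjoint_square_carrier[OF A] mat_adjoint_square_carrier[OF B]
    mat_adjoint_square_carrier[OF mult_carrier_mat[OF A B]]
  fix i j
  assume "i < dim_row (mat_adjoint B * mat_adjoint A)"
    and "j < dim_col (mat_adjoint B * mat_adjoint A)"
  then have ij: "i < n" "j < n" using carrs by auto
  show "mat_adjoint (A * B) $$ (i, j) = (mat_adjoint B * mat_adjoint A) $$ (i, j)"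
    using A B carrs ij
    by (simp add: mat_adjoint_index[OF mult_carrier_mat[OF A B]] scalar_prod_def
        mat_adjoint_index[OF A] mat_adjoint_index[OF B] mult.commute)
qed (use A B mat_adjoint_square_carrier[OF A] mat_adjoint_square_carrier[OF B]
    mat_adjoint_square_carrier[OF mult_carrier_mat[OF A B]] in auto)

lemma mat_adjoint_one: "mat_adjoint (1\<^sub>m n :: complex mat) = 1\<^sub>m n"
  using mat_adjoint_square_carrier[OF one_carrier_mat[where 'a = complex and n = n]]
  by (intro eq_matI) (auto simp: mat_adjoint_index[OF one_carrier_mat])

lemma unitary_mult:
  assumes A: "(A :: complex mat) \<in> carrier_mat n n" and B: "B \<in> carrier_mat n n"
    and AA: "A * mat_adjoint A = 1\<^sub>m n" and BB: "B * mat_adjoint B = 1\<^sub>m n"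
  shows "(A * B) * mat_adjoint (A * B) = 1\<^sub>m n"
proof -
  note C = mat_adjoint_square_carrier[OF A] mat_adjoint_square_carrier[OF B]
  have "(A * B) * mat_adjoint (A * B) = A * (B * (mat_adjoint B * mat_adjoint A))"
    unfolding mat_adjoint_mult[OF A B] using A B C by (simp add: assoc_mult_mat[of _ n n _ n _ n])
  also have "B * (mat_adjoint B * mat_adjoint A) = (B * mat_adjoint B) * mat_adjoint A"
    using A B C by (simp add: assoc_mult_mat[of _ n n _ n _ n])
  also have "A * \<dots> = 1\<^sub>m n" using A C AA BB by simp
  finally show ?thesis .
qed

lemma unitary_mult':
  assumes A: "(A :: complex mat) \<in> carrier_mat n n" and B: "B \<in> carrier_mat n n"
    and AA: "mat_adjoint A * A = 1\<^sub>m n" and BB: "mat_adjoint B * B = 1\<^sub>m n"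
  shows "mat_adjoint (A * B) * (A * B) = 1\<^sub>m n"
  using unitary_mult[OF mat_adjoint_square_carrier[OF B] mat_adjoint_square_carrier[OF A]] assms
  by (simp add: mat_adjoint_adjoint[OF A] mat_adjoint_adjoint[OF B] mat_adjoint_mult[OF A B, symmetric]
      mat_adjoint_adjoint[OF mult_carrier_mat[OF A B]])

lemma group_unitary_group: "group (unitary_group n)"
proof (rule groupI)
  fix x y assume "x \<in> carrier (unitary_group n)" "y \<in> carrier (unitary_group n)"
  then show "x \<otimes>\<^bsub>unitary_group n\<^esub> y \<in> carrier (unitary_group n)"
    by (auto simp: unitary_group_def unitary_mult unitary_mult')
next
  fix x assume "x \<in> carrier (unitary_group n)"
  then show "\<exists>y\<in>carrier (unitary_group n). y \<otimes>\<^bsub>unitary_group n\<^esub> x = \<one>\<^bsub>unitary_group n\<^esub>"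
    by (intro bexI[of _ "mat_adjoint x"])
       (auto simp: unitary_group_def mat_adjoint_square_carrier mat_adjoint_adjoint)
qed (auto simp: unitary_group_def mat_adjoint_one)

lemma inv_unitary_group:
  assumes "A \<in> carrier (unitary_group n)"
  shows "inv\<^bsub>unitary_group n\<^esub> A = mat_adjoint A"
  using assms
  by (intro group.inv_equality[OF group_unitary_group])
     (auto simp: unitary_group_def mat_adjoint_square_carrier mat_adjoint_adjoint)

end

theory Submission
  imports Defs "HOL-Library.FuncSet" "HOL-Library.Function_Algebras"
    "HOL-Analysis.L2_Norm" "HOL-Analysis.Topology_Euclidean_Space"
begin

text \<open>
  The proof is a Jordan-type argument. Write \<open>\<parallel>x\<parallel>\<close> for the distance of \<open>x\<close> to the identity, let \<open>Z\<close>
  be the centralizer in the group of the ball \<open>B = {x. \<parallel>x\<parallel> \<le> 1/8}\<close>, and let \<open>f r\<close> be the number of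
  \<open>Z\<close>-cosets met by \<open>\<Sigma>\<^sup>r\<close>. Taking commutators with elements of \<open>B\<close> contracts the distance to \<open>Z\<close>.
  Hence, if \<open>\<gamma>\<close> is a quotient \<open>a\<inverse>b \<notin> Z\<close> of elements of a finite set \<open>A \<subseteq> B\<close> that is closest
  to \<open>Z\<close>, the products \<open>a [x, \<gamma>]\<close> with \<open>a \<in> A\<close> are pairwise distinct modulo \<open>Z\<close>, which bounds the
  number of conjugates of \<open>\<gamma>\<close> under \<open>A\<close>. By pigeonhole many elements of \<open>A\<inverse>A\<close> centralize \<open>\<gamma>\<close>,
  quantitatively \<open>|A|\<^sup>2 \<le> f R |A'|\<close>. Iterating produces a strictly descending chain of centralizers,
  whose length is at most \<open>n\<^sup>2\<close>; therefore \<open>f r ^ q \<le> N (f (C r)) ^ (q - 1)\<close> with \<open>q = 2 ^ n\<^sup>2\<close> and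
  \<open>C = 2 ^ (n\<^sup>2 + 5)\<close>. Since \<open>f\<close> is unbounded unless the group is virtually abelian, this recursive
  inequality forces stretched exponential growth.
\<close>

section \<open>Centralizers and product sets\<close>

definition centralizer :: "('a, 'b) monoid_scheme \<Rightarrow> 'a set \<Rightarrow> 'a set" where
  "centralizer G S = {g \<in> carrier G. \<forall>s\<in>S. g \<otimes>\<^bsub>G\<^esub> s = s \<otimes>\<^bsub>G\<^esub> g}"

definition commutator :: "('a, 'b) monoid_scheme \<Rightarrow> 'a \<Rightarrow> 'a \<Rightarrow> 'a" where
  "commutator G x y = x \<otimes>\<^bsub>G\<^esub> y \<otimes>\<^bsub>G\<^esub> inv\<^bsub>G\<^esub> x \<otimes>\<^bsub>G\<^esub> inv\<^bsub>G\<^esub> y"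

text \<open>Centralizers shrink as sets grow, so inequality here means strict inclusion: the list
  encodes a strictly descending chain of centralizers, one step per entry.\<close>

definition centralizer_chain :: "('a, 'b) monoid_scheme \<Rightarrow> 'a list \<Rightarrow> bool" where
  "centralizer_chain G hs \<longleftrightarrow> set hs \<subseteq> carrier G \<and>
     (\<forall>i<length hs. centralizer G (set (take (Suc i) hs)) \<noteq> centralizer G (set (take i hs)))"

lemma centralizer_subset: "centralizer G S \<subseteq> carrier G"
  by (auto simp: centralizer_def)

lemma centralizer_antimono: "S \<subseteq> T \<Longrightarrow> centralizer G T \<subseteq> centralizer G S"
  by (auto simp: centralizer_def)

text \<open>The element \<open>g\<close> lies in the old centralizer and not in the new one.\<close>

lemma centralizer_chain_snoc:
  assumes "centralizer_chain G hs" "h \<in> carrier G" "g \<in> centralizer G (set hs)"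
    "g \<otimes>\<^bsub>G\<^esub> h \<noteq> h \<otimes>\<^bsub>G\<^esub> g"
  shows "centralizer_chain G (hs @ [h])"
proof -
  have "g \<notin> centralizer G (set (hs @ [h]))"
    using assms(4) by (auto simp: centralizer_def)
  then show ?thesis
    using assms unfolding centralizer_chain_def by (auto simp: less_Suc_eq)
qed

context group
begin

lemma inv_cancel_left [simp]:
  assumes "x \<in> carrier G" "y \<in> carrier G"
  shows "inv x \<otimes> (x \<otimes> y) = y" "x \<otimes> (inv x \<otimes> y) = y"
  using assms by (simp_all flip: m_assoc)

lemma commutator_closed [simp]:
  "x \<in> carrier G \<Longrightarrow> y \<in> carrier G \<Longrightarrow> commutator G x y \<in> carrier G"
  by (simp add: commutator_def)

lemma subgroup_centralizer:
  assumes "S \<subseteq> carrier G"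
  shows "subgroup (centralizer G S) G"
proof (rule subgroupI)
  show "centralizer G S \<noteq> {}"
    using assms by (auto simp: centralizer_def intro!: exI[of _ \<one>])
next
  fix a assume a: "a \<in> centralizer G S"
  show "inv a \<in> centralizer G S"
    unfolding centralizer_def
  proof (safe)
    fix s assume "s \<in> S"
    then have s: "s \<in> carrier G" and as: "a \<otimes> s = s \<otimes> a"
      using assms a by (auto simp: centralizer_def)
    have ac: "a \<in> carrier G" using a by (simp add: centralizer_def)
    have "inv a \<otimes> s = inv a \<otimes> (s \<otimes> a) \<otimes> inv a"
      using s ac by (simp add: m_assoc)
    also have "\<dots> = s \<otimes> inv a"
      using s ac by (simp add: as [symmetric] m_assoc)
    finally show "inv a \<otimes> s = s \<otimes> inv a" .
  qed (use a in \<open>auto simp: centralizer_def\<close>)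
next
  fix a b assume ab: "a \<in> centralizer G S" "b \<in> centralizer G S"
  show "a \<otimes> b \<in> centralizer G S"
    unfolding centralizer_def
  proof (safe)
    fix s assume "s \<in> S"
    then have s: "s \<in> carrier G" and "a \<otimes> s = s \<otimes> a" "b \<otimes> s = s \<otimes> b"
      using assms ab by (auto simp: centralizer_def)
    moreover have "a \<in> carrier G" "b \<in> carrier G" using ab by (auto simp: centralizer_def)
    ultimately show "a \<otimes> b \<otimes> s = s \<otimes> (a \<otimes> b)"
      by (metis m_assoc)
  qed (use ab in \<open>auto simp: centralizer_def\<close>)
qed (rule centralizer_subset)

lemma conj_nat_pow:
  assumes "x \<in> carrier G" "y \<in> carrier G"
  shows "(y \<otimes> x \<otimes> inv y) [^] (k::nat) = y \<otimes> x [^] k \<otimes> inv y"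
  using assms by (induction k) (simp_all add: m_assoc)

lemma subgroup_finite_index:
  assumes H: "subgroup H G"
    and fin: "finite (\<phi> ` carrier G)"
    and \<phi>: "\<And>x y. x \<in> carrier G \<Longrightarrow> y \<in> carrier G \<Longrightarrow> \<phi> x = \<phi> y \<Longrightarrow> inv x \<otimes> y \<in> H"
  shows "finite (rcosets H)"
proof -
  \<comment> \<open>Inverting first turns the left-coset hypothesis on \<open>\<phi>\<close> into
    the right-coset condition \<open>b \<otimes> inv a \<in> H\<close>.\<close>
  let ?\<psi> = "\<lambda>a. \<phi> (inv a)"
  have "H #> a = H #> inv_into (carrier G) ?\<psi> (?\<psi> a)" if a: "a \<in> carrier G" for a
  proof -
    define b where "b = inv_into (carrier G) ?\<psi> (?\<psi> a)"
    have b: "b \<in> carrier G" "?\<psi> b = ?\<psi> a"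
      using a unfolding b_def by (auto intro!: inv_into_into f_inv_into_f)
    have "b \<otimes> inv a \<in> H" using \<phi>[of "inv b" "inv a"] a b by simp
    then have "b \<in> H #> a"
      using a b by (auto simp: r_coset_def m_assoc intro!: bexI[of _ "b \<otimes> inv a"])
    then show ?thesis using repr_independence[OF _ a H] by (simp add: b_def)
  qed
  then have "rcosets H \<subseteq> (\<lambda>p. H #> inv_into (carrier G) ?\<psi> p) ` (\<phi> ` carrier G)"
    by (auto simp: RCOSETS_def)
  then show ?thesis using fin finite_subset by blast
qed

end

section \<open>Product sets, word length and generated subgroups\<close>

context monoid
begin

lemma product_set_closed: "S \<subseteq> carrier G \<Longrightarrow> product_set G S r \<subseteq> carrier G"
  by (induction r) (auto simp: set_mult_def)

lemma product_set_one:
  assumes "S \<subseteq> carrier G"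
  shows "product_set G S (Suc 0) = S"
proof -
  have "s \<in> carrier G" if "s \<in> S" for s using assms that by blast
  then show ?thesis by (force simp: set_mult_def)
qed

lemma product_set_finite: "finite S \<Longrightarrow> finite (product_set G S r)"
  by (induction r) (auto simp: set_mult_def)

lemma product_set_add:
  assumes "S \<subseteq> carrier G"
  shows "product_set G S (r + s) = product_set G S r <#> product_set G S s"
proof (induction s)
  case 0
  have "x \<in> carrier G" if "x \<in> product_set G S r" for x
    using product_set_closed[OF assms] that by blast
  then show ?case by (force simp: set_mult_def)
next
  case (Suc s)
  show ?case
    using assms product_set_closed[OF assms, of r] product_set_closed[OF assms, of s]
    by (simp add: Suc set_mult_def) (fastforce simp: m_assoc)
qed

lemma product_set_mult:
  assumes "S \<subseteq> carrier G" "x \<in> product_set G S r" "y \<in> product_set G S s"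
  shows "x \<otimes> y \<in> product_set G S (r + s)"
  using assms by (auto simp: product_set_add set_mult_def)

lemma card_product_set_le:
  assumes "finite S"
  shows "card (product_set G S r) \<le> card S ^ r"
proof (induction r)
  case (Suc r)
  have "product_set G S (Suc r) = (\<lambda>(x, y). x \<otimes> y) ` (product_set G S r \<times> S)"
    by (auto simp: set_mult_def)
  then have "card (product_set G S (Suc r)) \<le> card (product_set G S r \<times> S)"
    using assms by (metis card_image_le finite_cartesian_product product_set_finite)
  also have "\<dots> \<le> card S ^ r * card S"
    by (simp add: card_cartesian_product Suc)
  finally show ?case by (simp add: mult.commute)
qed simp

end

lemma (in group) product_set_inv:
  assumes "symmetric_subset G S" "x \<in> product_set G S r"
  shows "inv x \<in> product_set G S r"
  using assms(2)
proof (induction r arbitrary: x)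
  case (Suc r)
  have S: "S \<subseteq> carrier G" using assms by (simp add: symmetric_subset_def)
  obtain y s where ys: "y \<in> product_set G S r" "s \<in> S" "x = y \<otimes> s"
    using Suc.prems by (auto simp: set_mult_def)
  moreover have "y \<in> carrier G" "s \<in> carrier G"
    using ys S product_set_closed[OF S] by auto
  moreover have "inv s \<in> product_set G S 1"
    using assms ys by (simp add: symmetric_subset_def product_set_one del: product_set.simps)
  ultimately show ?case
    using product_set_mult[OF S, of "inv s" 1 "inv y" r] Suc.IH[of y]
    by (simp add: inv_mult_group)
qed simp

text \<open>Symmetry puts the inverses of generators back into \<open>S\<close>, and additivity of
  word length gives closure under products.\<close>

lemma (in group) generate_eq_Union_product_set:
  assumes S: "symmetric_subset G S"
  shows "generate G S = (\<Union>r. product_set G S r)"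
proof
  have Sc: "S \<subseteq> carrier G" using S by (simp add: symmetric_subset_def)
  have one: "s \<in> product_set G S 1" if "s \<in> S" for s
    using that Sc by (simp add: product_set_one del: product_set.simps)
  show "generate G S \<subseteq> (\<Union>r. product_set G S r)"
  proof
    fix x assume "x \<in> generate G S"
    then show "x \<in> (\<Union>r. product_set G S r)"
    proof induction
      case one
      have "\<one> \<in> product_set G S 0" by simp
      then show ?case by blast
    next
      case (incl h)
      then show ?case using one by blast
    next
      case (inv h)
      then show ?case using one S by (auto simp: symmetric_subset_def simp del: product_set.simps)
    next
      case (eng h1 h2)
      then show ?case using product_set_mult[OF Sc] by blast
    qed
  qed
  have "product_set G S r \<subseteq> generate G S" for r
    by (induction r) (auto simp: set_mult_def intro: generate.intros)
  then show "(\<Union>r. product_set G S r) \<subseteq> generate G S" by blast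
qed

text \<open>Some fiber has at least average size. It is returned through a member \<open>a\<close>
  because the fiber is later translated by \<open>inv a\<close>.\<close>

lemma pigeonhole_fiber:
  assumes "finite A" "A \<noteq> {}"
  obtains a where "a \<in> A" "card A \<le> card (f ` A) * card {b \<in> A. f b = f a}"
proof -
  obtain y where y: "y \<in> f ` A" "card A \<le> card (f -` {y} \<inter> A) * card (f ` A)"
    using pigeonhole_card[of f A "f ` A"] assms by auto
  then obtain a where a: "a \<in> A" "y = f a" by auto
  moreover have "f -` {y} \<inter> A = {b \<in> A. f b = f a}" using a by auto
  ultimately show ?thesis using y that by (simp add: mult.commute)
qed

section \<open>Groups with contracting commutators\<close>

text \<open>\<open>len x\<close> stands for \<open>\<parallel>x - 1\<parallel>\<close>; the lower bound for squares comes from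
  \<open>x\<^sup>2 - 1 = 2 (x - 1) + (x - 1)\<^sup>2\<close>.\<close>
locale commutator_contracting_group = group +
  fixes len :: "'a \<Rightarrow> real" and D :: nat
  assumes len_nonneg: "x \<in> carrier G \<Longrightarrow> 0 \<le> len x"
    and len_eq_0_iff: "x \<in> carrier G \<Longrightarrow> len x = 0 \<longleftrightarrow> x = \<one>"
    and len_mult: "x \<in> carrier G \<Longrightarrow> y \<in> carrier G \<Longrightarrow> len (x \<otimes> y) \<le> len x + len y"
    and len_inv: "x \<in> carrier G \<Longrightarrow> len (inv x) = len x"
    and len_conj: "x \<in> carrier G \<Longrightarrow> y \<in> carrier G \<Longrightarrow> len (y \<otimes> x \<otimes> inv y) = len x"
    and len_commutator:
      "x \<in> carrier G \<Longrightarrow> y \<in> carrier G \<Longrightarrow> len (commutator G x y) \<le> 2 * len x * len y"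
    and len_square: "x \<in> carrier G \<Longrightarrow> (2 - len x) * len x \<le> len (x \<otimes> x)"
    and totally_bounded: "0 < \<epsilon> \<Longrightarrow> \<exists>cell :: 'a \<Rightarrow> nat. finite (cell ` carrier G) \<and>
      (\<forall>x\<in>carrier G. \<forall>y\<in>carrier G. cell x = cell y \<longrightarrow> len (inv x \<otimes> y) \<le> \<epsilon>)"
    and centralizer_chain_length: "centralizer_chain G hs \<Longrightarrow> length hs \<le> D"
begin

lemma len_one [simp]: "len \<one> = 0"
  by (simp add: len_eq_0_iff)

text \<open>While lengths stay at most \<open>1/2\<close>, \<open>len_square\<close> makes each
  squaring multiply the length by at least \<open>3/2\<close>, so the powers \<open>2 ^ j\<close> of
  a nontrivial \<open>c\<close> would escape.\<close>

lemma no_small_subgroups: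
  assumes c: "c \<in> carrier G" and bound: "\<And>k::nat. len (c [^] k) \<le> 1/2"
  shows "c = \<one>"
proof -
  have grow: "(3/2) ^ j * len c \<le> len (c [^] (2 ^ j :: nat))" for j
  proof (induction j)
    case (Suc j)
    let ?x = "c [^] (2 ^ j :: nat)"
    have x: "?x \<in> carrier G" using c by simp
    have "(3/2) ^ Suc j * len c \<le> 3/2 * len ?x" using Suc by (simp add: mult.commute)
    also have "\<dots> \<le> (2 - len ?x) * len ?x"
      using bound[of "2 ^ j"] len_nonneg[OF x] by (intro mult_right_mono) auto
    also have "\<dots> \<le> len (?x \<otimes> ?x)" by (rule len_square[OF x])
    also have "?x \<otimes> ?x = c [^] (2 ^ Suc j :: nat)"
      using c by (simp add: nat_pow_mult mult_2)
    finally show ?case .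
  qed (use c in simp)
  have "len c = 0"
  proof (rule ccontr)
    assume "len c \<noteq> 0"
    then have "0 < len c" using len_nonneg[OF c] by simp
    moreover obtain j where "1 / len c < (3/2) ^ j"
      using real_arch_pow[of "3/2" "1 / len c"] by auto
    ultimately have "1 < (3/2) ^ j * len c" by (simp add: field_simps)
    then show False using grow[of j] bound[of "2 ^ j"] by simp
  qed
  then show ?thesis using c len_eq_0_iff by blast
qed

text \<open>If \<open>g\<close> commutes with \<open>y g y\<inverse> = g c\<close>, then \<open>c\<^sup>k = [g\<^sup>-\<^sup>k, y]\<close> stays near the identity for
  all \<open>k\<close>.\<close>
lemma commute_if_commute_conj:
  assumes y: "y \<in> carrier G" "len y \<le> 1/4" and g: "g \<in> carrier G"
    and comm: "g \<otimes> (y \<otimes> g \<otimes> inv y) = (y \<otimes> g \<otimes> inv y) \<otimes> g"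
  shows "y \<otimes> g = g \<otimes> y"
proof -
  define c where "c = inv g \<otimes> (y \<otimes> g \<otimes> inv y)"
  have c: "c \<in> carrier G" using y g by (simp add: c_def)
  have gc: "g \<otimes> c = y \<otimes> g \<otimes> inv y" using y g by (simp add: c_def)
  have "g \<otimes> c = inv g \<otimes> (g \<otimes> (y \<otimes> g \<otimes> inv y))" using y g by (simp add: gc)
  also have "\<dots> = c \<otimes> g" using y g by (simp only: comm) (simp add: c_def m_assoc)
  finally have gc': "g \<otimes> c = c \<otimes> g" .
  have "len (c [^] k) \<le> 1/2" for k :: nat
  proof -
    let ?h = "g [^] k"
    have h: "?h \<in> carrier G" using g by simp
    \<comment> \<open>Since \<open>g\<close> commutes with \<open>c\<close>, the power of
      \<open>g \<otimes> c\<close> splits into the powers of \<open>g\<close> and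
      \<open>c\<close>.\<close>
    have "y \<otimes> ?h \<otimes> inv y = ?h \<otimes> c [^] k"
      using conj_nat_pow[OF g y(1), of k] pow_mult_distrib[OF gc' g c] by (simp add: gc)
    then have "c [^] k = inv ?h \<otimes> (y \<otimes> ?h \<otimes> inv y)"
      using c h by simp
    \<comment> \<open>A conjugate of \<open>y\<close> times \<open>inv y\<close> has length at most
      \<open>2 * len y\<close> for every \<open>k\<close>; this explains the hypothesis
      \<open>len y \<le> 1/4\<close>.\<close>
    also have "\<dots> = (inv ?h \<otimes> y \<otimes> inv (inv ?h)) \<otimes> inv y"
      using y h by (simp add: m_assoc)
    also have "len \<dots> \<le> len (inv ?h \<otimes> y \<otimes> inv (inv ?h)) + len (inv y)"
      using y h by (intro len_mult) auto
    also have "\<dots> = 2 * len y"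
      using y h by (simp only: len_conj inv_closed len_inv)
    finally show ?thesis using y by simp
  qed
  then have "c = \<one>" using c by (rule no_small_subgroups[rotated])
  then have "y \<otimes> g \<otimes> inv y = g" using gc g by simp
  then have "y \<otimes> g \<otimes> inv y \<otimes> y = g \<otimes> y" by simp
  then show ?thesis using y g by (simp add: m_assoc)
qed

section \<open>The ball around the identity, its centralizer, and the displacement\<close>

text \<open>The radius \<open>1/8\<close> serves two ends: quotients of two elements have length at
  most \<open>1/4\<close>, as \<open>commute_if_commute_conj\<close> requires, and commutators with
  elements of the ball have at most a quarter of the displacement.\<close>

definition nbhd :: "'a set" where
  "nbhd = {x \<in> carrier G. len x \<le> 1/8}"

abbreviation Z :: "'a set" where
  "Z \<equiv> centralizer G nbhd"

text \<open>The quotients use \<open>0 / 0 = 0\<close> at \<open>x = \<one>\<close>, so \<open>\<one>\<close> contributes nothing to the supremum.\<close>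
definition displacement :: "'a \<Rightarrow> real" where
  "displacement g = (SUP x\<in>nbhd. len (commutator G x g) / len x)"

lemma nbhd_closed: "x \<in> nbhd \<Longrightarrow> x \<in> carrier G"
  by (simp add: nbhd_def)

lemma nbhd_subset: "nbhd \<subseteq> carrier G"
  by (auto simp: nbhd_def)

lemma one_in_nbhd: "\<one> \<in> nbhd"
  by (simp add: nbhd_def)

lemma nbhd_conj: "x \<in> nbhd \<Longrightarrow> y \<in> carrier G \<Longrightarrow> y \<otimes> x \<otimes> inv y \<in> nbhd"
  by (simp add: nbhd_def len_conj)

lemma Z_closed: "z \<in> Z \<Longrightarrow> z \<in> carrier G"
  by (simp add: centralizer_def)

lemma subgroup_Z: "subgroup Z G"
  by (rule subgroup_centralizer[OF nbhd_subset])

lemma commutator_quotient_le: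
  assumes "x \<in> nbhd" "g \<in> carrier G"
  shows "len (commutator G x g) / len x \<le> 2 * len g"
proof (cases "len x = 0")
  case False
  then have "0 < len x" using assms len_nonneg[of x] by (simp add: nbhd_def)
  then show ?thesis
    using len_commutator[of x g] assms nbhd_closed by (simp add: field_simps)
qed (use assms len_nonneg in auto)

lemma bdd_above_displacement:
  "g \<in> carrier G \<Longrightarrow> bdd_above ((\<lambda>x. len (commutator G x g) / len x) ` nbhd)"
  using commutator_quotient_le by (intro bdd_aboveI2[where M = "2 * len g"])

lemma displacement_leI:
  assumes g: "g \<in> carrier G" and b: "0 \<le> b"
    and le: "\<And>x. x \<in> nbhd \<Longrightarrow> len (commutator G x g) \<le> len x * b"
  shows "displacement g \<le> b"
  unfolding displacement_def
proof (rule cSUP_least)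
  fix x assume x: "x \<in> nbhd"
  then have "0 \<le> len x" using nbhd_closed len_nonneg by blast
  then show "len (commutator G x g) / len x \<le> b"
    using le[OF x] b by (cases "len x = 0") (auto simp: field_simps)
qed (use one_in_nbhd in auto)

lemma len_commutator_le:
  assumes x: "x \<in> nbhd" and g: "g \<in> carrier G"
  shows "len (commutator G x g) \<le> len x * displacement g"
proof (cases "x = \<one>")
  case True
  then show ?thesis using g by (simp add: commutator_def)
next
  case False
  then have "0 < len x"
    using x nbhd_closed len_nonneg[of x] len_eq_0_iff[of x] by fastforce
  moreover have "len (commutator G x g) / len x \<le> displacement g"
    unfolding displacement_def by (rule cSUP_upper[OF x bdd_above_displacement[OF g]])
  ultimately show ?thesis by (simp add: field_simps)
qed

lemma displacement_le: "g \<in> carrier G \<Longrightarrow> displacement g \<le> 2 * len g"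
  using len_commutator nbhd_closed len_nonneg
  by (intro displacement_leI) (auto simp: mult_ac)

lemma displacement_nonneg:
  assumes "g \<in> carrier G"
  shows "0 \<le> displacement g"
proof -
  have "len (commutator G \<one> g) / len \<one> \<le> displacement g"
    unfolding displacement_def
    by (rule cSUP_upper[OF one_in_nbhd bdd_above_displacement[OF assms]])
  then show ?thesis by simp
qed

text \<open>With \<open>displacement_inv\<close> and \<open>displacement_eq_0_iff\<close> this makes
  \<open>displacement (inv a \<otimes> b)\<close> a pseudometric that vanishes exactly when
  \<open>a\<close> and \<open>b\<close> agree modulo \<open>Z\<close>.\<close>

lemma displacement_mult:
  assumes g: "g \<in> carrier G" and h: "h \<in> carrier G"
  shows "displacement (g \<otimes> h) \<le> displacement g + displacement h"
proof (rule displacement_leI)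
  fix x assume x: "x \<in> nbhd"
  have xc: "x \<in> carrier G" using x by (rule nbhd_closed)
  have "commutator G x (g \<otimes> h) = commutator G x g \<otimes> (g \<otimes> commutator G x h \<otimes> inv g)"
    using xc g h by (simp add: commutator_def m_assoc inv_mult_group)
  then have "len (commutator G x (g \<otimes> h)) \<le> len (commutator G x g) + len (commutator G x h)"
    using len_mult[of "commutator G x g" "g \<otimes> commutator G x h \<otimes> inv g"] xc g h
    by (simp add: len_conj)
  also have "\<dots> \<le> len x * (displacement g + displacement h)"
    using len_commutator_le[OF x g] len_commutator_le[OF x h] by (simp add: distrib_left)
  finally show "len (commutator G x (g \<otimes> h)) \<le> len x * (displacement g + displacement h)" .
qed (use g h displacement_nonneg in auto)

lemma displacement_inv:
  assumes g: "g \<in> carrier G"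
  shows "displacement (inv g) \<le> displacement g"
proof (rule displacement_leI)
  fix x assume x: "x \<in> nbhd"
  have xc: "x \<in> carrier G" using x by (rule nbhd_closed)
  have "commutator G x (inv g) = inv (inv g \<otimes> commutator G x g \<otimes> inv (inv g))"
    using xc g by (simp add: commutator_def m_assoc inv_mult_group)
  then have "len (commutator G x (inv g)) = len (commutator G x g)"
    using xc g by (simp only: len_inv len_conj commutator_closed inv_closed m_closed)
  then show "len (commutator G x (inv g)) \<le> len x * displacement g"
    using len_commutator_le[OF x g] by simp
qed (use g displacement_nonneg in auto)

text \<open>Conjugation by \<open>t\<close> permutes the ball and preserves lengths, so it only
  reindexes the supremum.\<close>

lemma displacement_conj:
  assumes g: "g \<in> carrier G" and t: "t \<in> carrier G"
  shows "displacement (t \<otimes> g \<otimes> inv t) \<le> displacement g"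
proof (rule displacement_leI)
  fix x assume x: "x \<in> nbhd"
  have xc: "x \<in> carrier G" using x by (rule nbhd_closed)
  define y where "y = inv t \<otimes> x \<otimes> inv (inv t)"
  have y: "y \<in> nbhd" "y \<in> carrier G" "len y = len x"
    unfolding y_def using nbhd_conj[OF x, of "inv t"] xc t len_conj[of x "inv t"] by auto
  have "commutator G x (t \<otimes> g \<otimes> inv t) = t \<otimes> commutator G y g \<otimes> inv t"
    using xc g t by (simp add: commutator_def y_def m_assoc inv_mult_group)
  then have "len (commutator G x (t \<otimes> g \<otimes> inv t)) = len (commutator G y g)"
    using y g t by (simp add: len_conj)
  then show "len (commutator G x (t \<otimes> g \<otimes> inv t)) \<le> len x * displacement g"
    using len_commutator_le[OF y(1) g] y by simp
qed (use g t displacement_nonneg in auto)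

text \<open>The contraction behind the whole argument. The factor \<open>1/4\<close> is the constant
  2 of \<open>displacement_le\<close> times the radius \<open>1/8\<close>.\<close>

lemma displacement_commutator:
  assumes x: "x \<in> nbhd" and g: "g \<in> carrier G"
  shows "displacement (commutator G x g) \<le> displacement g / 4"
proof -
  have "displacement (commutator G x g) \<le> 2 * (len x * displacement g)"
    using displacement_le[of "commutator G x g"] len_commutator_le[OF x g] x g nbhd_closed
    by fastforce
  also have "\<dots> \<le> 2 * (1/8 * displacement g)"
    using x displacement_nonneg[OF g] by (intro mult_left_mono mult_right_mono) (auto simp: nbhd_def)
  finally show ?thesis by simp
qed

lemma commutator_eq_one_iff:
  assumes "x \<in> carrier G" "y \<in> carrier G"
  shows "commutator G x y = \<one> \<longleftrightarrow> x \<otimes> y = y \<otimes> x"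
proof -
  have "commutator G x y = (x \<otimes> y) \<otimes> inv (y \<otimes> x)"
    using assms by (simp add: commutator_def inv_mult_group m_assoc)
  then show ?thesis
    using assms inv_solve_right'[of \<one> "x \<otimes> y" "y \<otimes> x"] by auto
qed

lemma displacement_eq_0_iff:
  assumes g: "g \<in> carrier G"
  shows "displacement g = 0 \<longleftrightarrow> g \<in> Z"
proof
  assume 0: "displacement g = 0"
  have "g \<otimes> x = x \<otimes> g" if x: "x \<in> nbhd" for x
  proof -
    have xc: "x \<in> carrier G" using x by (rule nbhd_closed)
    then have "len (commutator G x g) = 0"
      using len_commutator_le[OF x g] 0 len_nonneg[of "commutator G x g"] g by simp
    then show ?thesis using commutator_eq_one_iff[OF xc g] len_eq_0_iff xc g by simp
  qed
  then show "g \<in> Z" using g by (simp add: centralizer_def)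
next
  assume "g \<in> Z"
  then have "commutator G x g = \<one>" if "x \<in> nbhd" for x
    using that g commutator_eq_one_iff[of x g] nbhd_closed by (auto simp: centralizer_def)
  then have "displacement g \<le> 0"
    using g by (intro displacement_leI) auto
  then show "displacement g = 0" using displacement_nonneg[OF g] by simp
qed

section \<open>Cosets modulo \<open>Z\<close> and the bound on the number of conjugates\<close>

text \<open>This is the left coset of \<open>x\<close>; left cosets are compatible with the left
  translations used below.\<close>

definition Zclass :: "'a \<Rightarrow> 'a set" where
  "Zclass x = {y \<in> carrier G. inv x \<otimes> y \<in> Z}"

lemma Zclass_eq_iff:
  assumes "x \<in> carrier G" "y \<in> carrier G"
  shows "Zclass x = Zclass y \<longleftrightarrow> inv x \<otimes> y \<in> Z"
proof
  assume "Zclass x = Zclass y"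
  moreover have "y \<in> Zclass y"
    using assms subgroup.one_closed[OF subgroup_Z] by (simp add: Zclass_def)
  ultimately show "inv x \<otimes> y \<in> Z" by (auto simp: Zclass_def)
next
  assume xy: "inv x \<otimes> y \<in> Z"
  have "inv x \<otimes> z \<in> Z \<longleftrightarrow> inv y \<otimes> z \<in> Z" if z: "z \<in> carrier G" for z
  proof
    assume "inv x \<otimes> z \<in> Z"
    then have "inv (inv x \<otimes> y) \<otimes> (inv x \<otimes> z) \<in> Z"
      using xy subgroup_Z by (meson subgroup.m_closed subgroup.m_inv_closed)
    then show "inv y \<otimes> z \<in> Z" using assms z by (simp add: inv_mult_group m_assoc)
  next
    assume "inv y \<otimes> z \<in> Z"
    then have "(inv x \<otimes> y) \<otimes> (inv y \<otimes> z) \<in> Z"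
      using xy subgroup_Z by (meson subgroup.m_closed)
    then show "inv x \<otimes> z \<in> Z" using assms z by (simp add: m_assoc)
  qed
  then show "Zclass x = Zclass y" by (auto simp: Zclass_def)
qed

lemma Zclass_left_mult:
  assumes "g \<in> carrier G" "x \<in> carrier G" "y \<in> carrier G"
  shows "Zclass (g \<otimes> x) = Zclass (g \<otimes> y) \<longleftrightarrow> Zclass x = Zclass y"
  using assms by (simp add: Zclass_eq_iff inv_mult_group m_assoc)

text \<open>If two classes agree, \<open>inv a \<otimes> b\<close> is a product of two commutators
  with \<open>\<gamma>\<close> and an element of \<open>Z\<close>, so its displacement is at most
  half that of \<open>\<gamma>\<close>; minimality forces \<open>a = b\<close>. Then
  \<open>u = inv x \<otimes> y\<close> conjugates \<open>\<gamma>\<close> to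
  \<open>\<gamma> \<otimes> z\<close> with \<open>z \<in> Z\<close>, which commutes with
  \<open>\<gamma>\<close>. Hence \<open>u\<close> commutes with \<open>\<gamma>\<close> by
  \<open>commute_if_commute_conj\<close>, and \<open>x\<close>, \<open>y\<close> give the same
  conjugate.\<close>

lemma inj_on_mult_commutator:
  assumes A: "A \<subseteq> nbhd" and \<gamma>: "\<gamma> \<in> nbhd" "\<gamma> \<notin> Z"
    and min: "\<And>a b. a \<in> A \<Longrightarrow> b \<in> A \<Longrightarrow> a \<noteq> b \<Longrightarrow> displacement \<gamma> \<le> displacement (inv a \<otimes> b)"
    and X: "X \<subseteq> A" "inj_on (\<lambda>x. x \<otimes> \<gamma> \<otimes> inv x) X"
  shows "inj_on (\<lambda>(a, x). Zclass (a \<otimes> commutator G x \<gamma>)) (A \<times> X)"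
proof (rule inj_onI, clarify)
  fix a x b y
  assume a: "a \<in> A" and b: "b \<in> A" and x: "x \<in> X" and y: "y \<in> X"
    and eq: "Zclass (a \<otimes> commutator G x \<gamma>) = Zclass (b \<otimes> commutator G y \<gamma>)"
  have xn: "x \<in> nbhd" and yn: "y \<in> nbhd" using x y X A by auto
  have carr: "a \<in> carrier G" "b \<in> carrier G" "x \<in> carrier G" "y \<in> carrier G" "\<gamma> \<in> carrier G"
    using a b xn yn \<gamma> A nbhd_closed by auto
  define c d where "c = commutator G x \<gamma>" and "d = commutator G y \<gamma>"
  have cd: "c \<in> carrier G" "d \<in> carrier G" using carr by (simp_all add: c_def d_def)
  have pos: "0 < displacement \<gamma>"
    using displacement_eq_0_iff[of \<gamma>] displacement_nonneg[of \<gamma>] \<gamma> carr by fastforce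
  define z where "z = inv (a \<otimes> c) \<otimes> (b \<otimes> d)"
  have z: "z \<in> Z" using eq Zclass_eq_iff[of "a \<otimes> c" "b \<otimes> d"] carr cd
    by (simp add: z_def c_def d_def)
  have zc: "z \<in> carrier G" using z by (rule Z_closed)
  have "a = b"
  proof (rule ccontr)
    assume "a \<noteq> b"
    then have "displacement \<gamma> \<le> displacement (inv a \<otimes> b)" using min a b by blast
    also have "inv a \<otimes> b = c \<otimes> z \<otimes> inv d"
      using carr cd by (simp add: z_def inv_mult_group m_assoc)
    also have "displacement \<dots> \<le> displacement c + displacement z + displacement d"
      using displacement_mult[of "c \<otimes> z" "inv d"] displacement_mult[of c z]
        displacement_inv[of d] cd zc by simp
    also have "displacement z = 0" using z zc displacement_eq_0_iff by blast
    also have "displacement c + 0 + displacement d \<le> displacement \<gamma> / 2"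
      using displacement_commutator[OF xn, of \<gamma>] displacement_commutator[OF yn, of \<gamma>] carr
      by (simp add: c_def d_def)
    finally show False using pos by simp
  qed
  define u where "u = inv x \<otimes> y"
  have u: "u \<in> carrier G" using carr by (simp add: u_def)
  have "z = inv c \<otimes> d" using \<open>a = b\<close> carr cd by (simp add: z_def inv_mult_group m_assoc)
  \<comment> \<open>The conjugations by \<open>\<gamma>\<close> and \<open>x\<close> on the left
    leave \<open>z\<close> unchanged, since both elements lie in the ball that \<open>z\<close>
    centralizes.\<close>
  then have "inv x \<otimes> (inv \<gamma> \<otimes> z \<otimes> \<gamma>) \<otimes> x = inv \<gamma> \<otimes> (u \<otimes> \<gamma> \<otimes> inv u)"
    using carr by (simp add: c_def d_def u_def commutator_def inv_mult_group m_assoc)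
  moreover have z\<gamma>: "z \<otimes> \<gamma> = \<gamma> \<otimes> z" and zx: "z \<otimes> x = x \<otimes> z"
    using z \<gamma> xn by (auto simp: centralizer_def)
  have "inv x \<otimes> (inv \<gamma> \<otimes> z \<otimes> \<gamma>) \<otimes> x = z"
    using carr zc by (simp add: m_assoc z\<gamma> zx)
  ultimately have "u \<otimes> \<gamma> \<otimes> inv u = \<gamma> \<otimes> z"
    using carr u by simp
  then have "\<gamma> \<otimes> (u \<otimes> \<gamma> \<otimes> inv u) = (u \<otimes> \<gamma> \<otimes> inv u) \<otimes> \<gamma>"
    using carr zc by (simp add: m_assoc z\<gamma>)
  moreover have "len u \<le> 1/4"
    using len_mult[of "inv x" y] xn yn carr by (simp add: u_def nbhd_def len_inv)
  ultimately have "u \<otimes> \<gamma> = \<gamma> \<otimes> u"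
    using commute_if_commute_conj[of u \<gamma>] u carr by blast
  then have "x \<otimes> (u \<otimes> \<gamma>) \<otimes> inv y = x \<otimes> (\<gamma> \<otimes> u) \<otimes> inv y" by simp
  then have "y \<otimes> \<gamma> \<otimes> inv y = x \<otimes> \<gamma> \<otimes> inv x"
    using carr by (simp add: u_def m_assoc)
  then have "x = y" using X(2) x y by (auto dest: inj_onD)
  then show "a = b \<and> x = y" using \<open>a = b\<close> by simp
qed

text \<open>Injectivity is applied to a set \<open>X\<close> with one representative for each
  conjugate of \<open>\<gamma>\<close> under \<open>A\<close>.\<close>

lemma card_mult_conj_le:
  assumes A: "A \<subseteq> nbhd" "finite A" and \<gamma>: "\<gamma> \<in> nbhd" "\<gamma> \<notin> Z"
    and min: "\<And>a b. a \<in> A \<Longrightarrow> b \<in> A \<Longrightarrow> a \<noteq> b \<Longrightarrow> displacement \<gamma> \<le> displacement (inv a \<otimes> b)"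
    and R: "finite R" "\<And>a x. a \<in> A \<Longrightarrow> x \<in> A \<Longrightarrow> a \<otimes> commutator G x \<gamma> \<in> R"
  shows "card A * card ((\<lambda>x. x \<otimes> \<gamma> \<otimes> inv x) ` A) \<le> card (Zclass ` R)"
proof -
  obtain X where X: "X \<subseteq> A" "inj_on (\<lambda>x. x \<otimes> \<gamma> \<otimes> inv x) X"
      "(\<lambda>x. x \<otimes> \<gamma> \<otimes> inv x) ` A = (\<lambda>x. x \<otimes> \<gamma> \<otimes> inv x) ` X"
    using subset_image_inj[of "(\<lambda>x. x \<otimes> \<gamma> \<otimes> inv x) ` A" "\<lambda>x. x \<otimes> \<gamma> \<otimes> inv x" A] by auto
  have "card A * card ((\<lambda>x. x \<otimes> \<gamma> \<otimes> inv x) ` A) = card (A \<times> X)"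
    using X by (simp add: card_image card_cartesian_product)
  also have "\<dots> \<le> card (Zclass ` R)"
    using inj_on_mult_commutator[OF A(1) \<gamma> min X(1,2)] R X(1)
    by (intro card_inj_on_le) auto
  finally show ?thesis .
qed


section \<open>Descending centralizer chains and the recursive inequality\<close>

text \<open>A chain inside the ball of maximal length exists by the bound \<open>D\<close>; were its
  centralizer larger than \<open>Z\<close>, it could be prolonged. Finiteness of \<open>T\<close>
  later gives one word length that reaches all of \<open>T\<close>.\<close>

lemma finite_nbhd_centralizer:
  obtains T where "finite T" "T \<subseteq> nbhd" "centralizer G T = Z"
proof -
  let ?C = "\<lambda>hs. centralizer_chain G hs \<and> set hs \<subseteq> nbhd"
  have "?C []" by (simp add: centralizer_chain_def)
  then obtain hs where hs: "?C hs" and max: "\<And>hs'. ?C hs' \<Longrightarrow> length hs' \<le> length hs"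
    using ex_has_greatest_nat[of ?C "[]" length "Suc D"] centralizer_chain_length
    by (metis le_imp_less_Suc)
  have "centralizer G (set hs) \<subseteq> Z"
  proof
    fix g assume g: "g \<in> centralizer G (set hs)"
    have "g \<otimes> b = b \<otimes> g" if b: "b \<in> nbhd" for b
    proof (rule ccontr)
      assume "g \<otimes> b \<noteq> b \<otimes> g"
      then have "?C (hs @ [b])"
        using centralizer_chain_snoc[of G hs b g] hs g b nbhd_closed by auto
      then show False using max by fastforce
    qed
    then show "g \<in> Z" using g by (simp add: centralizer_def)
  qed
  then show ?thesis
    using that[of "set hs"] hs centralizer_antimono[of "set hs" nbhd G] by auto
qed

text \<open>Contrapositive of \<open>commute_if_commute_conj\<close>; it supplies the next entry of
  a centralizer chain as a conjugate of \<open>g\<close>.\<close>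

lemma exists_noncommuting_conj:
  assumes T: "T \<subseteq> nbhd" "centralizer G T = Z" and g: "g \<in> carrier G" "g \<notin> Z"
  obtains t where "t \<in> T" "g \<otimes> (t \<otimes> g \<otimes> inv t) \<noteq> (t \<otimes> g \<otimes> inv t) \<otimes> g"
proof -
  obtain t where t: "t \<in> T" "g \<otimes> t \<noteq> t \<otimes> g"
  proof -
    have "g \<notin> centralizer G T" using g T(2) by simp
    then show ?thesis using that g(1) by (auto simp: centralizer_def)
  qed
  then have "t \<in> carrier G" "len t \<le> 1/4" using T by (auto simp: nbhd_def)
  then show ?thesis using commute_if_commute_conj[of t g] g t that by metis
qed

text \<open>The product sets need not be nested, as \<open>S\<close> may omit the identity. Instead,
  left multiplication by one \<open>g \<in> S\<close> injects the classes of one product set into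
  those of the next.\<close>

lemma card_Zclass_product_set_mono:
  assumes S: "S \<subseteq> carrier G" "S \<noteq> {}" "finite S" and "r \<le> s"
  shows "card (Zclass ` product_set G S r) \<le> card (Zclass ` product_set G S s)"
  using \<open>r \<le> s\<close>
proof (rule lift_Suc_mono_le[rotated])
  fix r
  obtain g where g: "g \<in> S" using S by blast
  then have gc: "g \<in> carrier G" and g1: "g \<in> product_set G S (Suc 0)"
    using S by (auto simp add: product_set_one simp del: product_set.simps)
  obtain X where X: "X \<subseteq> product_set G S r" "inj_on Zclass X"
      "Zclass ` product_set G S r = Zclass ` X"
    using subset_image_inj[of "Zclass ` product_set G S r" Zclass "product_set G S r"] by auto
  have Xc: "x \<in> carrier G" if "x \<in> X" for x
    using X(1) that product_set_closed[OF S(1)] by blast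
  have "inj_on (\<lambda>x. Zclass (g \<otimes> x)) X"
    using X(2) gc Xc by (auto simp: inj_on_def Zclass_left_mult)
  moreover have "g \<otimes> x \<in> product_set G S (Suc r)" if "x \<in> X" for x
    using product_set_mult[OF S(1) g1, of x r] that X(1) by auto
  ultimately have "card X \<le> card (Zclass ` product_set G S (Suc r))"
    using product_set_finite[OF S(3), of "Suc r"] by (intro card_inj_on_le) auto
  then show "card (Zclass ` product_set G S r) \<le> card (Zclass ` product_set G S (Suc r))"
    using X by (simp add: card_image)
qed

text \<open>The induction on \<open>k\<close> passes from \<open>A\<close> to a fiber of \<open>a \<mapsto> a h a\<inverse>\<close> with \<open>h = t \<gamma> t\<inverse>\<close>. Conjugating by
  \<open>t\<close> ensures that \<open>\<gamma>\<close>, which centralizes \<open>hs\<close>, does not commute with \<open>h\<close>, so that \<open>hs @ [h]\<close> is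
  again a strict chain.\<close>
lemma card_power_le:
  assumes S: "symmetric_subset G S" "finite S" "S \<noteq> {}"
    and T: "T \<subseteq> nbhd" "centralizer G T = Z" "\<And>t. t \<in> T \<Longrightarrow> \<exists>j\<le>l. t \<in> product_set G S j"
    and F: "F = card (Zclass ` product_set G S R)" "0 < F"
  shows "centralizer_chain G hs \<Longrightarrow> D \<le> length hs + k \<Longrightarrow> A \<subseteq> product_set G S s \<Longrightarrow>
    inj_on Zclass A \<Longrightarrow> (\<And>a. a \<in> A \<Longrightarrow> len a \<le> 1/8 / 2 ^ k) \<Longrightarrow> A \<subseteq> centralizer G (set hs) \<Longrightarrow>
    7 * 2 ^ k * s + 4 * l \<le> R \<Longrightarrow> card A ^ (2 ^ k) \<le> F ^ (2 ^ k - 1)"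
proof (induction k arbitrary: hs A s)
  case 0
  \<comment> \<open>The chain already has the maximal length \<open>D\<close>; two elements of
    \<open>A\<close> would produce a chain with one more entry.\<close>
  have "card A \<le> 1"
  proof (rule ccontr)
    assume "\<not> card A \<le> 1"
    moreover from this have "finite A" by (metis card.infinite le0)
    ultimately obtain a b where ab: "a \<in> A" "b \<in> A" "a \<noteq> b"
      by (auto simp: card_le_Suc0_iff_eq)
    have carr: "a \<in> carrier G" "b \<in> carrier G"
      using ab 0(6) by (auto simp: centralizer_def)
    define g where "g = inv a \<otimes> b"
    have g: "g \<in> carrier G" "g \<notin> Z" "g \<in> centralizer G (set hs)"
      using ab carr 0(4,6) Zclass_eq_iff[of a b] subgroup_centralizer[of "set hs"] 0(1)
      by (auto simp: g_def inj_on_def centralizer_chain_def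
          intro!: subgroup.m_closed subgroup.m_inv_closed)
    then obtain t where "t \<in> T" "g \<otimes> (t \<otimes> g \<otimes> inv t) \<noteq> (t \<otimes> g \<otimes> inv t) \<otimes> g"
      using exists_noncommuting_conj[OF T(1,2)] by metis
    then have "centralizer_chain G (hs @ [t \<otimes> g \<otimes> inv t])"
      using T(1) g 0(1) nbhd_closed by (intro centralizer_chain_snoc[where g = g]) auto
    then show False using centralizer_chain_length 0(2) by fastforce
  qed
  then show ?case by simp
next
  case (Suc k)
  have Sc: "S \<subseteq> carrier G" using S by (simp add: symmetric_subset_def)
  have finA: "finite A"
    using Suc.prems(3) product_set_finite[OF S(2)] finite_subset by blast
  have carr: "a \<in> carrier G" if "a \<in> A" for a
    using that Suc.prems(6) by (auto simp: centralizer_def)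
  have sub: "subgroup (centralizer G (set hs)) G"
    using Suc.prems(1) by (intro subgroup_centralizer) (simp add: centralizer_chain_def)
  have len_inv_mult: "len (inv a \<otimes> b) \<le> 1/8 / 2 ^ k" if "a \<in> A" "b \<in> A" for a b
    using len_mult[of "inv a" b] Suc.prems(5)[OF that(1)] Suc.prems(5)[OF that(2)] carr that
    by (simp add: len_inv)
  have small: "1/8 / 2 ^ i \<le> (1/8 :: real)" for i :: nat by (simp add: field_simps)
  have inv_mult: "inv a \<otimes> b \<in> product_set G S (2 * s)" if "a \<in> A" "b \<in> A" for a b
    using product_set_mult[OF Sc product_set_inv[OF S(1)], of a s b s] that Suc.prems(3)
    by (auto simp: mult_2)
  have inv_mult_cent: "inv a \<otimes> b \<in> centralizer G (set hs)" if "a \<in> A" "b \<in> A" for a b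
    using sub Suc.prems(6) that by (meson subgroup.m_closed subgroup.m_inv_closed subsetD)
  define Q where "Q = (\<lambda>(a, b). inv a \<otimes> b) ` {(a, b). a \<in> A \<and> b \<in> A \<and> a \<noteq> b}"
  show ?case
  proof (cases "Q = {}")
    case True
    then have "card A \<le> 1"
      using finA by (auto simp: Q_def card_le_Suc0_iff_eq)
    then have "card A ^ 2 ^ Suc k \<le> 1 ^ 2 ^ Suc k" by (intro power_mono) auto
    also have "\<dots> \<le> F ^ (2 ^ Suc k - 1)" using F(2) by simp
    finally show ?thesis .
  next
    case False
    have "finite Q"
      unfolding Q_def
      by (rule finite_imageI) (rule finite_subset[of _ "A \<times> A"], use finA in auto)
    \<comment> \<open>This \<open>g\<close> is the \<open>\<gamma>\<close> of the remark
      above.\<close>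
    then obtain g where gQ: "g \<in> Q"
      and gmin: "\<And>h. h \<in> Q \<Longrightarrow> displacement g \<le> displacement h"
      using arg_min_if_finite[of Q displacement] False by (metis not_less)
    obtain a0 b0 where ab0: "a0 \<in> A" "b0 \<in> A" "a0 \<noteq> b0" "g = inv a0 \<otimes> b0"
      using gQ by (auto simp: Q_def)
    have g: "g \<in> carrier G" "len g \<le> 1/8" "g \<in> product_set G S (2 * s)"
        "g \<in> centralizer G (set hs)"
      using ab0 carr order_trans[OF len_inv_mult[of a0 b0] small] inv_mult inv_mult_cent by auto
    have gZ: "g \<notin> Z"
      using ab0 Suc.prems(4) Zclass_eq_iff[of a0 b0] carr by (auto simp: inj_on_def)
    obtain t where t: "t \<in> T" "g \<otimes> (t \<otimes> g \<otimes> inv t) \<noteq> (t \<otimes> g \<otimes> inv t) \<otimes> g"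
      using exists_noncommuting_conj[OF T(1,2) g(1) gZ] by metis
    have tc: "t \<in> carrier G" using t(1) T(1) nbhd_closed by auto
    obtain j where j: "j \<le> l" "t \<in> product_set G S j" using T(3)[OF t(1)] by blast
    define h where "h = t \<otimes> g \<otimes> inv t"
    have h: "h \<in> carrier G" "h \<in> nbhd" "g \<otimes> h \<noteq> h \<otimes> g"
      using g t tc by (auto simp: h_def nbhd_def len_conj)
    have hP: "h \<in> product_set G S (2 * s + 2 * j)"
      using product_set_mult[OF Sc product_set_mult[OF Sc j(2) g(3)] product_set_inv[OF S(1) j(2)]]
      by (simp add: h_def mult_2 ac_simps)
    have hZ: "h \<notin> Z"
    proof
      assume "h \<in> Z"
      moreover have "g \<in> nbhd" using g by (simp add: nbhd_def)
      ultimately show False using h by (auto simp: centralizer_def)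
    qed
    \<comment> \<open>Conjugation does not increase displacement, so \<open>h\<close> inherits the
      minimality of \<open>g\<close>.\<close>
    have hmin: "displacement h \<le> displacement (inv a \<otimes> b)" if "a \<in> A" "b \<in> A" "a \<noteq> b" for a b
      using displacement_conj[OF g(1) tc] gmin[of "inv a \<otimes> b"] that
      by (force simp: h_def Q_def)
    \<comment> \<open>Word lengths: \<open>s\<close> for \<open>a\<close>, \<open>s\<close> for each
      of the two occurrences of \<open>x\<close>, and \<open>2 * s + 2 * j\<close> for each of the
      two of \<open>h\<close>.\<close>
    have prod: "a \<otimes> commutator G x h \<in> product_set G S (7 * s + 4 * j)"
      if "a \<in> A" "x \<in> A" for a x
    proof -
      have ax: "a \<in> product_set G S s" "x \<in> product_set G S s" using that Suc.prems(3) by auto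
      have "a \<otimes> commutator G x h \<in>
          product_set G S (s + (s + (2 * s + 2 * j) + s + (2 * s + 2 * j)))"
        unfolding commutator_def
        using ax hP by (intro product_set_mult[OF Sc] product_set_inv[OF S(1)])
      also have "s + (s + (2 * s + 2 * j) + s + (2 * s + 2 * j)) = 7 * s + 4 * j" by simp
      finally show ?thesis .
    qed
    have An: "A \<subseteq> nbhd"
    proof
      fix a assume a: "a \<in> A"
      show "a \<in> nbhd"
        using order_trans[OF Suc.prems(5)[OF a] small] carr[OF a] by (simp add: nbhd_def)
    qed
    let ?conj = "\<lambda>a. a \<otimes> h \<otimes> inv a"
    have "7 * s * 1 \<le> 7 * s * 2 ^ Suc k" by (intro mult_le_mono2) (rule one_le_power, simp)
    also have "\<dots> = 7 * 2 ^ Suc k * s" by simp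
    finally have "7 * s + 4 * j \<le> R" using Suc.prems(7) j(1) by linarith
    then have "card (Zclass ` product_set G S (7 * s + 4 * j)) \<le> F"
      unfolding F(1) by (rule card_Zclass_product_set_mono[OF Sc S(3,2)])
    then have le1: "card A * card (?conj ` A) \<le> F"
      using card_mult_conj_le[OF An finA h(2) hZ hmin product_set_finite[OF S(2)] prod]
      by (rule order_trans[rotated])
    obtain a where a: "a \<in> A" "card A \<le> card (?conj ` A) * card {b \<in> A. ?conj b = ?conj a}"
      using pigeonhole_fiber[OF finA] ab0(1) by blast
    \<comment> \<open>Elements giving the same conjugate of \<open>h\<close> differ by an element
      that centralizes \<open>h\<close>. The translation doubles both word length and radius, which
      the factors \<open>2 ^ k\<close> in the hypotheses absorb.\<close>
    define A' where "A' = (\<lambda>b. inv a \<otimes> b) ` {b \<in> A. ?conj b = ?conj a}"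
    have inj: "inj_on (\<lambda>b. inv a \<otimes> b) A"
      using carr a(1) by (auto simp: inj_on_def)
    have cardA': "card A' = card {b \<in> A. ?conj b = ?conj a}"
      unfolding A'_def by (intro card_image inj_on_subset[OF inj]) auto
    have "card A' ^ 2 ^ k \<le> F ^ (2 ^ k - 1)"
    proof (rule Suc.IH)
      show "centralizer_chain G (hs @ [h])"
        using Suc.prems(1) h g by (intro centralizer_chain_snoc[where g = g]) auto
      show "D \<le> length (hs @ [h]) + k" using Suc.prems(2) by simp
      show "A' \<subseteq> product_set G S (2 * s)"
        using inv_mult a(1) by (auto simp: A'_def)
      show "inj_on Zclass A'"
        using Suc.prems(4) a(1) carr by (auto simp: A'_def inj_on_def Zclass_left_mult)
      show "len b \<le> 1/8 / 2 ^ k" if "b \<in> A'" for b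
        using that len_inv_mult a(1) by (auto simp: A'_def)
      show "A' \<subseteq> centralizer G (set (hs @ [h]))"
      proof
        fix u assume "u \<in> A'"
        then obtain b where b: "b \<in> A" "?conj b = ?conj a" "u = inv a \<otimes> b"
          by (auto simp: A'_def)
        have ab: "a \<in> carrier G" "b \<in> carrier G" using a(1) b(1) carr by auto
        have "inv a \<otimes> ?conj b \<otimes> b = u \<otimes> h" "inv a \<otimes> ?conj a \<otimes> b = h \<otimes> u"
          using ab h(1) by (simp_all add: b(3) m_assoc)
        then have "u \<otimes> h = h \<otimes> u" using b(2) by simp
        then show "u \<in> centralizer G (set (hs @ [h]))"
          using inv_mult_cent[OF a(1) b(1)] b(3) by (auto simp: centralizer_def)
      qed
      show "7 * 2 ^ k * (2 * s) + 4 * l \<le> R" using Suc.prems(7) by (simp add: mult_ac)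
    qed
    moreover have "(card A)\<^sup>2 \<le> F * card A'"
    proof -
      have "(card A)\<^sup>2 \<le> card A * (card (?conj ` A) * card A')"
        unfolding power2_eq_square using a(2) cardA' by (intro mult_le_mono) auto
      also have "\<dots> \<le> F * card A'" using le1 by (simp add: mult.assoc [symmetric])
      finally show ?thesis .
    qed
    \<comment> \<open>Raising the inequality between \<open>A\<close> and \<open>A'\<close> to the
      power \<open>2 ^ k\<close> makes the exponents of \<open>F\<close> add up to
      \<open>2 ^ Suc k - 1\<close>.\<close>
    ultimately have "(card A)\<^sup>2 ^ 2 ^ k \<le> F ^ 2 ^ k * F ^ (2 ^ k - 1)"
      using power_mono[of "(card A)\<^sup>2" "F * card A'" "2 ^ k"]
      by (auto simp: power_mult_distrib elim!: order_trans intro!: mult_le_mono)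
    also have "\<dots> = F ^ (2 ^ Suc k - 1)"
      by (simp flip: power_add add: mult_2)
    finally show ?thesis by (simp add: power_mult)
  qed
qed

text \<open>Among representatives of the classes, one cell of small diameter holds at least a
  fraction \<open>1 / M\<close>. Translated to the identity, it enters \<open>card_power_le\<close>
  with the empty chain and \<open>k = D\<close>; the loss \<open>M ^ (2 ^ D)\<close> becomes
  \<open>N\<close>.\<close>

lemma card_Zclass_power_le:
  assumes S: "symmetric_subset G S" "finite S" "S \<noteq> {}" "carrier G = generate G S"
  obtains N l where "0 < N"
    "\<And>r. l \<le> r \<Longrightarrow> card (Zclass ` product_set G S r) ^ (2 ^ D) \<le>
       N * card (Zclass ` product_set G S (2 ^ (D + 5) * r)) ^ (2 ^ D - 1)"
proof -
  let ?P = "product_set G S"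
  have Sc: "S \<subseteq> carrier G" using S by (simp add: symmetric_subset_def)
  obtain T where T: "finite T" "T \<subseteq> nbhd" "centralizer G T = Z"
    by (rule finite_nbhd_centralizer)
  have "\<exists>j. t \<in> ?P j" if "t \<in> T" for t
    using that T(2) nbhd_closed S(4) generate_eq_Union_product_set[OF S(1)] by blast
  then obtain wl where wl: "\<And>t. t \<in> T \<Longrightarrow> t \<in> ?P (wl t)" by metis
  \<comment> \<open>The inserted 0 keeps \<open>Max\<close> meaningful when \<open>T\<close> is
    empty.\<close>
  define l where "l = Max (insert 0 (wl ` T))"
  have l: "\<exists>j\<le>l. t \<in> ?P j" if "t \<in> T" for t
    using wl[OF that] T(1) that by (auto simp: l_def intro!: exI[of _ "wl t"])
  obtain cell :: "'a \<Rightarrow> nat" where cell: "finite (cell ` carrier G)"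
      "\<And>x y. x \<in> carrier G \<Longrightarrow> y \<in> carrier G \<Longrightarrow> cell x = cell y \<Longrightarrow>
         len (inv x \<otimes> y) \<le> 1/8 / 2 ^ D"
    using totally_bounded[of "1/8 / 2 ^ D"] by auto
  define M where "M = card (cell ` carrier G)"
  have M: "0 < M" using cell(1) by (auto simp: M_def card_gt_0_iff)
  have "card (Zclass ` ?P r) ^ (2 ^ D) \<le>
       M ^ (2 ^ D) * card (Zclass ` ?P (2 ^ (D + 5) * r)) ^ (2 ^ D - 1)" if r: "l \<le> r" for r
  proof -
    define F where "F = card (Zclass ` ?P (2 ^ (D + 5) * r))"
    have P_ne: "?P i \<noteq> {}" for i
      using S(3) by (induction i) (auto simp: set_mult_def)
    have Pc: "x \<in> carrier G" if "x \<in> ?P i" for x i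
      using that product_set_closed[OF Sc] by blast
    have F: "0 < F" using P_ne product_set_finite[OF S(2)] by (auto simp: F_def card_gt_0_iff)
    obtain A where A: "A \<subseteq> ?P r" "inj_on Zclass A" "Zclass ` ?P r = Zclass ` A"
      using subset_image_inj[of "Zclass ` ?P r" Zclass "?P r"] by auto
    have finA: "finite A" using A(1) product_set_finite[OF S(2)] finite_subset by blast
    have Ac: "x \<in> carrier G" if "x \<in> A" for x using that A(1) Pc by blast
    have "A \<noteq> {}" using A(3) P_ne by auto
    then obtain a where a: "a \<in> A" "card A \<le> card (cell ` A) * card {b \<in> A. cell b = cell a}"
      using pigeonhole_fiber[OF finA] by blast
    define A' where "A' = (\<lambda>b. inv a \<otimes> b) ` {b \<in> A. cell b = cell a}"
    have inj: "inj_on (\<lambda>b. inv a \<otimes> b) A"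
      using Ac a(1) by (auto simp: inj_on_def)
    have cardA': "card A' = card {b \<in> A. cell b = cell a}"
      unfolding A'_def by (intro card_image inj_on_subset[OF inj]) auto
    have "card A' ^ 2 ^ D \<le> F ^ (2 ^ D - 1)"
    proof (rule card_power_le[OF S(1-3) T(2,3) l F_def F])
      show "centralizer_chain G []" by (simp add: centralizer_chain_def)
      show "D \<le> length [] + D" by simp
      show "A' \<subseteq> ?P (2 * r)"
        using product_set_mult[OF Sc product_set_inv[OF S(1)], of a r _ r] a(1) A(1)
        by (auto simp: A'_def mult_2)
      show "inj_on Zclass A'"
        using A(2) a(1) Ac by (auto simp: A'_def inj_on_def Zclass_left_mult)
      show "len b \<le> 1/8 / 2 ^ D" if "b \<in> A'" for b
        using that cell(2) Ac a(1) by (auto simp: A'_def)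
      show "A' \<subseteq> centralizer G (set [])"
        using Ac a(1) by (auto simp: A'_def centralizer_def)
      \<comment> \<open>The word length needed is at most \<open>(14 + 4) * 2 ^ D * r\<close>, and
        32 is the next power of two above 18.\<close>
      have "4 * l \<le> 4 * (2 ^ D * r)" using r by (intro mult_le_mono2) (simp add: le_trans)
      also have "7 * 2 ^ D * (2 * r) + \<dots> \<le> 2 ^ (D + 5) * r" by (simp add: power_add)
      finally show "7 * 2 ^ D * (2 * r) + 4 * l \<le> 2 ^ (D + 5) * r" by simp
    qed
    moreover have "card (Zclass ` ?P r) \<le> M * card A'"
    proof -
      have "card (cell ` A) \<le> M"
        unfolding M_def using cell(1) Ac by (intro card_mono) auto
      then have "card A \<le> M * card A'"
        using a(2) cardA' by (metis mult_le_mono1 order_trans)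
      then show ?thesis using A by (simp add: card_image)
    qed
    ultimately show ?thesis
      using power_mono[of "card (Zclass ` ?P r)" "M * card A'" "2 ^ D"]
      by (auto simp: power_mult_distrib F_def elim!: order_trans)
  qed
  then show ?thesis using that[of "M ^ (2 ^ D)" l] M by simp
qed

section \<open>Boundedly many cosets force virtual commutativity\<close>

text \<open>The bound leaves only finitely many \<open>Z\<close>-classes in the whole group.
  Elements sharing both class and cell differ by an element of \<open>Z \<inter> nbhd\<close>, whose
  elements commute pairwise, so an abelian subgroup containing this set has finite index.\<close>

lemma virtually_abelian_if_bounded:
  assumes S: "symmetric_subset G S" "finite S" "carrier G = generate G S"
    and bound: "\<And>r. card (Zclass ` product_set G S r) \<le> M"
  shows "virtually_abelian G"
proof -
  let ?P = "product_set G S"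
  have Sc: "S \<subseteq> carrier G" using S by (simp add: symmetric_subset_def)
  have carr: "carrier G = (\<Union>r. ?P r)"
    using S generate_eq_Union_product_set by simp
  \<comment> \<open>If the union were infinite, \<open>M + 1\<close> of its points would already lie
    in a single \<open>X r\<close>.\<close>
  have fin_incr: "finite (\<Union>r. X r)"
    if X: "\<And>r. X r \<subseteq> X (Suc r)" "\<And>r. finite (X r)" "\<And>r. card (X r) \<le> M"
    for X :: "nat \<Rightarrow> 'a set set"
  proof (rule ccontr)
    assume "infinite (\<Union>r. X r)"
    then obtain Y where Y: "Y \<subseteq> (\<Union>r. X r)" "finite Y" "card Y = Suc M"
      using infinite_arbitrarily_large by blast
    have mono: "X i \<subseteq> X j" if "i \<le> j" for i j
      by (rule lift_Suc_mono_le[of X, OF X(1) that])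
    have "\<exists>r. Y \<subseteq> X r"
      using Y(2,1)
    proof (induction Y rule: finite_induct)
      case (insert y Y)
      then obtain i j where "Y \<subseteq> X i" "y \<in> X j" by auto
      then have "insert y Y \<subseteq> X (max i j)"
        using mono[of i "max i j"] mono[of j "max i j"] by auto
      then show ?case by blast
    qed simp
    then obtain r where "Y \<subseteq> X r" by blast
    then have "Suc M \<le> card (X r)" using Y X(2) card_mono by metis
    then show False using X(3)[of r] by simp
  qed
  have "finite (Zclass ` carrier G)"
  proof (cases "S = {}")
    case True
    have "?P r \<subseteq> {\<one>}" for r using True by (cases r) (auto simp: set_mult_def)
    then have "carrier G \<subseteq> {\<one>}" using carr by auto
    then show ?thesis using finite_subset by blast
  next
    case False
    then obtain s where s: "s \<in> S" by blast
    \<comment> \<open>The identity is a product of two generators but perhaps not of one, so nesting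
      holds only among exponents of equal parity; the two parities are treated separately.\<close>
    have one2: "\<one> \<in> ?P 2"
    proof -
      have "s \<in> ?P (Suc 0)" "inv s \<in> ?P (Suc 0)"
        using s S(1) by (auto simp: product_set_one Sc symmetric_subset_def simp del: product_set.simps)
      then show ?thesis
        using product_set_mult[OF Sc, of s "Suc 0" "inv s" "Suc 0"] s Sc by (auto simp: numeral_2_eq_2)
    qed
    have step: "?P r \<subseteq> ?P (r + 2)" for r
      using product_set_mult[OF Sc _ one2, of _ r] product_set_closed[OF Sc, of r]
      by fastforce
    have "finite (\<Union>r. Zclass ` ?P (2 * r + i))" for i
    proof (rule fin_incr)
      show "Zclass ` ?P (2 * r + i) \<subseteq> Zclass ` ?P (2 * Suc r + i)" for r
        using step[of "2 * r + i"] by (auto simp: add.commute)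
    qed (use product_set_finite[OF S(2)] bound in auto)
    moreover have "Zclass ` carrier G \<subseteq>
        (\<Union>r. Zclass ` ?P (2 * r + 0)) \<union> (\<Union>r. Zclass ` ?P (2 * r + 1))"
    proof
      fix z assume "z \<in> Zclass ` carrier G"
      then obtain r where r: "z \<in> Zclass ` ?P r" using carr by auto
      have "r = 2 * (r div 2) + 0 \<or> r = 2 * (r div 2) + 1" by presburger
      then show "z \<in> (\<Union>r. Zclass ` ?P (2 * r + 0)) \<union> (\<Union>r. Zclass ` ?P (2 * r + 1))"
      proof
        assume "r = 2 * (r div 2) + 0"
        then have "z \<in> Zclass ` ?P (2 * (r div 2) + 0)" using r by simp
        then show ?thesis by blast
      next
        assume "r = 2 * (r div 2) + 1"
        then have "z \<in> Zclass ` ?P (2 * (r div 2) + 1)" using r by (simp only:)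
        then show ?thesis by blast
      qed
    qed
    ultimately show ?thesis using finite_subset by blast
  qed
  moreover obtain cell :: "'a \<Rightarrow> nat" where cell: "finite (cell ` carrier G)"
      "\<And>x y. x \<in> carrier G \<Longrightarrow> y \<in> carrier G \<Longrightarrow> cell x = cell y \<Longrightarrow> len (inv x \<otimes> y) \<le> 1/8"
    using totally_bounded[of "1/8"] by auto
  ultimately have "finite (Zclass ` carrier G \<times> cell ` carrier G)" by blast
  then have fin: "finite ((\<lambda>x. (Zclass x, cell x)) ` carrier G)"
    by (rule finite_subset[rotated]) auto
  \<comment> \<open>\<open>W\<close> is the double centralizer of the commuting set
    \<open>Z \<inter> nbhd\<close>. That set lies in \<open>Y\<close>, hence so does
    \<open>W\<close>, and \<open>W\<close> centralizes \<open>Y\<close>; thus \<open>W\<close> is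
    abelian.\<close>
  define Y where "Y = centralizer G (Z \<inter> nbhd)"
  define W where "W = centralizer G Y"
  have YZ: "Z \<inter> nbhd \<subseteq> Y"
    using nbhd_closed by (auto simp: Y_def centralizer_def)
  have "W \<subseteq> centralizer G (Z \<inter> nbhd)"
    unfolding W_def by (rule centralizer_antimono[OF YZ])
  then have WY: "W \<subseteq> Y" by (simp only: Y_def)
  have ZW: "Z \<inter> nbhd \<subseteq> W"
    using nbhd_closed by (auto simp: W_def Y_def centralizer_def)
  have W: "subgroup W G"
    unfolding W_def Y_def by (intro subgroup_centralizer centralizer_subset)
  have "comm_group (G\<lparr>carrier := W\<rparr>)"
  proof (rule group.group_comm_groupI)
    show "group (G\<lparr>carrier := W\<rparr>)" by (rule subgroup_imp_group[OF W])
  next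
    fix x y assume "x \<in> carrier (G\<lparr>carrier := W\<rparr>)" "y \<in> carrier (G\<lparr>carrier := W\<rparr>)"
    then have "x \<in> W" "y \<in> Y" using WY by auto
    then show "x \<otimes>\<^bsub>G\<lparr>carrier := W\<rparr>\<^esub> y = y \<otimes>\<^bsub>G\<lparr>carrier := W\<rparr>\<^esub> x"
      by (simp add: W_def centralizer_def)
  qed
  moreover have "finite (rcosets W)"
  proof (rule subgroup_finite_index[OF W fin])
    fix x y assume xy: "x \<in> carrier G" "y \<in> carrier G"
      and eq: "(Zclass x, cell x) = (Zclass y, cell y)"
    then have "inv x \<otimes> y \<in> Z \<inter> nbhd"
      using Zclass_eq_iff[OF xy] cell(2)[OF xy] by (simp add: nbhd_def)
    then show "inv x \<otimes> y \<in> W" using ZW by blast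
  qed
  ultimately show ?thesis using W by (auto simp: virtually_abelian_def)
qed

end

section \<open>Stretched exponential growth\<close>

text \<open>In logarithms the recursion bounds \<open>q * L r\<close> by
  \<open>ln N + (q - 1) * L (C * r)\<close>. Once \<open>L r\<close> is at least
  \<open>2 * ln N\<close>, passing from \<open>r\<close> to \<open>C * r\<close> multiplies
  \<open>L\<close> by at least \<open>\<mu> = 1 + 1 / (2 * q)\<close>, and \<open>\<mu>\<close> is
  \<open>C\<close> to the power \<open>\<alpha>\<close>. The maximum with 2 covers small
  \<open>r\<close>, where only positivity of \<open>f\<close> is available.\<close>

lemma stretched_exponential_growth:
  fixes f :: "nat \<Rightarrow> nat"
  assumes mono: "\<And>r s. r \<le> s \<Longrightarrow> f r \<le> f s" and pos: "\<And>r. 0 < f r"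
    and q: "0 < q" and C: "2 \<le> C" and N: "0 < N"
    and rec: "\<And>r. l \<le> r \<Longrightarrow> f r ^ q \<le> N * f (C * r) ^ (q - 1)"
    and unbounded: "\<And>M. \<exists>r. M < f r"
  obtains c :: real where "0 < c"
    "\<And>r. 1 \<le> r \<Longrightarrow> 2 powr (c * real r powr log C (1 + 1 / (2 * q))) \<le> max 2 (f r)"
proof -
  define \<mu> where "\<mu> = 1 + 1 / (2 * real q)"
  define \<alpha> where "\<alpha> = log C \<mu>"
  define L where "L r = ln (real (f r))" for r
  have \<mu>: "1 < \<mu>" using q by (simp add: \<mu>_def)
  have C\<alpha>: "real C powr \<alpha> = \<mu>" using C \<mu> by (simp add: \<alpha>_def)
  have \<alpha>: "0 < \<alpha>" using C \<mu> by (simp add: \<alpha>_def)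
  have L_mono: "L r \<le> L s" if "r \<le> s" for r s
    using mono[OF that] pos by (simp add: L_def)
  have L_rec: "q * L r \<le> ln N + (real q - 1) * L (C * r)" if "l \<le> r" for r
  proof -
    have "real (f r) ^ q \<le> N * real (f (C * r)) ^ (q - 1)"
      using rec[OF that] by (simp flip: of_nat_power of_nat_mult)
    then have "ln (real (f r) ^ q) \<le> ln (N * real (f (C * r)) ^ (q - 1))"
      using pos N by (subst ln_le_cancel_iff) auto
    then show ?thesis
      using pos N q by (simp add: ln_mult ln_realpow L_def of_nat_diff)
  qed
  \<comment> \<open>Exceeding \<open>N ^ 2\<close> lets half of \<open>L r\<close> absorb
    \<open>ln N\<close>; exceeding 1 makes \<open>L r0\<close> positive.\<close>
  obtain r1 where r1: "max 1 (N ^ 2) < f r1" using unbounded by blast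
  define r0 where "r0 = max (max l 1) r1"
  have r0: "l \<le> r0" "0 < r0" by (auto simp: r0_def)
  have f0: "max 1 (N ^ 2) < f r0" using r1 mono[of r1 r0] by (simp add: r0_def)
  have L0: "0 < L r0" using f0 by (simp add: L_def)
  have "2 * ln N = ln (real N ^ 2)" using N by (simp add: ln_realpow)
  also have "\<dots> \<le> L r0"
    using f0 N by (auto simp: L_def simp flip: of_nat_power)
  finally have L0N: "2 * ln N \<le> L r0" .
  have grow: "\<mu> ^ i * L r0 \<le> L (C ^ i * r0)" for i
  proof (induction i)
    case (Suc i)
    define r where "r = C ^ i * r0"
    have "r0 \<le> r" using C by (simp add: r_def)
    then have Lr: "L r0 \<le> L r" and lr: "l \<le> r" using L_mono r0 by auto
    have main: "(real q - 1/2) * L r \<le> (real q - 1) * L (C * r)"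
      using L_rec[OF lr] Lr L0N by (simp add: algebra_simps)
    \<comment> \<open>For \<open>q = 1\<close> the right side of \<open>main\<close> vanishes while
      the left side is positive.\<close>
    have "q \<noteq> 1" using main Lr L0 by auto
    then have q2: "0 < real q - 1" using q by auto
    have "(real q - 1) * (\<mu> * L r) \<le> (real q - 1/2) * L r"
    proof -
      have "(real q - 1) * \<mu> \<le> real q - 1/2"
        using q by (simp add: \<mu>_def field_simps)
      then show ?thesis using Lr L0 by (simp only: mult.assoc [symmetric] mult_right_mono)
    qed
    then have "\<mu> * L r \<le> L (C * r)"
      using main q2 by (meson mult_le_cancel_left_pos order_trans)
    moreover have "\<mu> ^ Suc i * L r0 \<le> \<mu> * L r"
      using Suc \<mu> by (simp add: r_def mult.assoc)
    ultimately show ?case by (simp add: r_def mult.assoc)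
  qed simp
  \<comment> \<open>\<open>c1\<close> serves \<open>r \<ge> r0\<close>, with \<open>r\<close>
    compared to the next point \<open>C ^ Suc i * r0\<close> and \<open>ln 2\<close> changing the
    base; \<open>c2\<close> keeps the exponent at most 1 for \<open>r < r0\<close>.\<close>
  define c1 where "c1 = L r0 / (real C * real r0) powr \<alpha> / ln 2"
  define c2 where "c2 = 1 / real r0 powr \<alpha>"
  have Cr0: "0 < real C * real r0" using C r0 by simp
  have c1: "0 < c1" and c2: "0 < c2" using L0 C r0 by (auto simp: c1_def c2_def intro!: divide_pos_pos)
  have bound: "2 powr (min c1 c2 * real r powr \<alpha>) \<le> max 2 (f r)" if "1 \<le> r" for r
  proof (cases "r < r0")
    case True
    have "min c1 c2 * real r powr \<alpha> \<le> c2 * real r0 powr \<alpha>"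
      using True c2 \<alpha> by (intro mult_mono powr_mono2) auto
    also have "\<dots> = 1" using r0 by (simp add: c2_def)
    finally have "2 powr (min c1 c2 * real r powr \<alpha>) \<le> 2 powr 1"
      by (subst powr_le_cancel_iff) auto
    then show ?thesis by simp
  next
    case False
    have "\<exists>j. r < C ^ j * r0"
    proof
      have "r < 2 ^ r" by simp
      also have "\<dots> \<le> C ^ r * r0" using C r0 by (metis One_nat_def Suc_leI mult.right_neutral mult_le_mono power_mono zero_le)
      finally show "r < C ^ r * r0" .
    qed
    \<comment> \<open>The least such \<open>j\<close> is positive because \<open>r0 \<le> r\<close>,
      so \<open>r\<close> lies between two consecutive points \<open>C ^ i * r0\<close> and
      \<open>C ^ Suc i * r0\<close>.\<close>
    then obtain j where j: "r < C ^ j * r0" "\<And>i. i < j \<Longrightarrow> C ^ i * r0 \<le> r"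
      using exists_least_iff[of "\<lambda>j. r < C ^ j * r0"] by (auto simp: not_less)
    then have "j \<noteq> 0" using False by (cases j) auto
    then obtain i where ji: "j = Suc i" using not0_implies_Suc by blast
    have "real r \<le> real (C ^ i * (C * r0))"
      using j(1) ji by (simp only: of_nat_le_iff power_Suc) (simp add: mult_ac)
    then have "real r powr \<alpha> \<le> (real C ^ i * (real C * real r0)) powr \<alpha>"
      using \<alpha> by (intro powr_mono2) auto
    also have "\<dots> = \<mu> ^ i * (real C * real r0) powr \<alpha>"
      using C by (simp add: powr_mult powr_powr C\<alpha> [symmetric] powr_realpow [symmetric] mult.commute)
    finally have "real r powr \<alpha> / (real C * real r0) powr \<alpha> \<le> \<mu> ^ i"
      using C r0 by (simp add: divide_le_eq)
    then have "real r powr \<alpha> / (real C * real r0) powr \<alpha> * L r0 \<le> \<mu> ^ i * L r0"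
      using L0 by (intro mult_right_mono) auto
    then have "c1 * real r powr \<alpha> * ln 2 \<le> \<mu> ^ i * L r0"
      by (simp add: c1_def mult.commute)
    also have "\<dots> \<le> L (C ^ i * r0)" by (rule grow)
    also have "\<dots> \<le> L r" using j(2)[of i] ji by (intro L_mono) simp
    finally have "c1 * real r powr \<alpha> * ln 2 \<le> L r" .
    then have "min c1 c2 * real r powr \<alpha> * ln 2 \<le> L r"
      by (elim order_trans[rotated]) (intro mult_right_mono, auto)
    then have "2 powr (min c1 c2 * real r powr \<alpha>) \<le> exp (L r)"
      by (simp add: powr_def)
    also have "exp (L r) = f r" using pos by (simp add: L_def)
    finally show ?thesis by simp
  qed
  show ?thesis
    using that[of "min c1 c2"] c1 c2 bound by (simp add: \<alpha>_def \<mu>_def)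
qed

context commutator_contracting_group
begin

text \<open>The growth lemma is applied to the coset count with \<open>q = 2 ^ D\<close> and
  \<open>C = 2 ^ (D + 5)\<close>. Its maximum with 2 disappears because product sets of positive
  exponent have at least two elements.\<close>

theorem growth_lower_bound:
  assumes S: "symmetric_subset G S" "finite S" "carrier G = generate G S"
    and not_va: "\<not> virtually_abelian G"
  obtains c :: real where "0 < c"
    "\<And>r. 1 \<le> r \<Longrightarrow> 2 powr (c * real r powr log (2 ^ (D + 5)) (1 + 1 / (2 * 2 ^ D))) \<le>
       card (product_set G S r)"
proof -
  have Sc: "S \<subseteq> carrier G" using S by (simp add: symmetric_subset_def)
  define f where "f r = card (Zclass ` product_set G S r)" for r
  have unbounded: "\<exists>r. M < f r" for M
    using virtually_abelian_if_bounded[OF S, of M] not_va unfolding f_def by (meson not_le)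
  have f_le: "f r \<le> card (product_set G S r)" for r
    unfolding f_def by (intro card_image_le product_set_finite S)
  \<comment> \<open>With at most one generator every product set has at most one element, against
    unboundedness of \<open>f\<close>.\<close>
  have card_S: "2 \<le> card S"
  proof (rule ccontr)
    assume "\<not> 2 \<le> card S"
    then have "card S ^ r \<le> 1" for r using power_mono[of "card S" 1 r] by simp
    then have "f r \<le> 1" for r
      using f_le[of r] card_product_set_le[OF S(2), of r] by (meson order_trans)
    then show False using unbounded[of 1] by (meson not_less)
  qed
  then have S_ne: "S \<noteq> {}" by auto
  have f_mono: "f r \<le> f s" if "r \<le> s" for r s
    unfolding f_def using card_Zclass_product_set_mono[OF Sc S_ne S(2) that] .
  have f_pos: "0 < f r" for r
    using f_mono[of 0 r] by (simp add: f_def)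
  have card_ge_2: "2 \<le> card (product_set G S r)" if "1 \<le> r" for r
  proof -
    obtain k where k: "r = Suc k" using \<open>1 \<le> r\<close> by (cases r) auto
    have "product_set G S k \<noteq> {}" using f_pos[of k] by (auto simp: f_def)
    then obtain g where g: "g \<in> product_set G S k" by blast
    have "(\<lambda>s. g \<otimes> s) ` S \<subseteq> product_set G S r"
      using g by (auto simp: k set_mult_def)
    moreover have "inj_on (\<lambda>s. g \<otimes> s) S"
      using g product_set_closed[OF Sc, of k] Sc by (intro inj_onI) (auto simp: subset_eq)
    ultimately have "card S \<le> card (product_set G S r)"
      using product_set_finite[OF S(2)] by (metis card_image card_mono)
    then show ?thesis using card_S by simp
  qed
  obtain N l where N: "0 < N"
    and rec: "\<And>r. l \<le> r \<Longrightarrow> f r ^ (2 ^ D) \<le> N * f (2 ^ (D + 5) * r) ^ (2 ^ D - 1)"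
    using card_Zclass_power_le[OF S(1,2) S_ne S(3)] unfolding f_def by metis
  have "2 \<le> (2 ^ (D + 5) :: nat)" by (simp add: power_add)
  then obtain c :: real where "0 < c" and c: "\<And>r. 1 \<le> r \<Longrightarrow>
      2 powr (c * real r powr log (2 ^ (D + 5)) (1 + 1 / (2 * 2 ^ D))) \<le> max 2 (f r)"
    using stretched_exponential_growth[of f "2 ^ D" "2 ^ (D + 5)" N l] f_mono f_pos N rec unbounded
    by auto
  moreover have "max 2 (f r) \<le> card (product_set G S r)" if "1 \<le> r" for r
    using card_ge_2[OF that] f_le[of r] by simp
  ultimately show ?thesis using that[of c] by (meson of_nat_le_iff order_trans)
qed

end

section \<open>The Frobenius norm on unitary matrices\<close>

text \<open>The Frobenius norm is submultiplicative, which gives the commutator estimate, and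
  invariant under unitary factors on either side, which gives invariance under conjugation.\<close>

definition frob :: "complex mat \<Rightarrow> real" where
  "frob A = L2_set (\<lambda>p. cmod (A $$ p)) ({..<dim_row A} \<times> {..<dim_col A})"

lemma frob_nonneg: "0 \<le> frob A"
  by (simp add: frob_def)

lemma frob_eq_0_iff:
  assumes "A \<in> carrier_mat n n"
  shows "frob A = 0 \<longleftrightarrow> A = 0\<^sub>m n n"
  using assms by (auto simp: frob_def L2_set_eq_0_iff intro!: eq_matI)

lemma frob_power2:
  assumes "A \<in> carrier_mat n n"
  shows "(frob A)\<^sup>2 = (\<Sum>i<n. \<Sum>j<n. (cmod (A $$ (i, j)))\<^sup>2)"
  using assms by (simp add: frob_def L2_set_def sum_nonneg sum.cartesian_product)

lemma cmod_index_le_frob: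
  assumes "A \<in> carrier_mat n n" "i < n" "j < n"
  shows "cmod (A $$ (i, j)) \<le> frob A"
  unfolding frob_def
  using assms member_le_L2_set[of "{..<n} \<times> {..<n}" "(i, j)" "\<lambda>p. cmod (A $$ p)"] by auto

lemma frob_le:
  assumes "A \<in> carrier_mat n n" "\<And>i j. i < n \<Longrightarrow> j < n \<Longrightarrow> cmod (A $$ (i, j)) \<le> b"
  shows "frob A \<le> real (n * n) * b"
proof -
  have "frob A \<le> (\<Sum>p\<in>{..<n} \<times> {..<n}. cmod (A $$ p))"
    using L2_set_le_sum_abs[of "\<lambda>p. cmod (A $$ p)" "{..<n} \<times> {..<n}"] assms(1)
    by (simp add: frob_def)
  also have "\<dots> \<le> (\<Sum>p\<in>{..<n} \<times> {..<n}. b)"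
    using assms(2) by (intro sum_mono) auto
  finally show ?thesis by (simp add: card_cartesian_product)
qed

lemma frob_add:
  assumes A: "A \<in> carrier_mat n n" and B: "B \<in> carrier_mat n n"
  shows "frob (A + B) \<le> frob A + frob B"
proof -
  let ?I = "{..<n} \<times> {..<n}"
  have "frob (A + B) \<le> L2_set (\<lambda>p. cmod (A $$ p) + cmod (B $$ p)) ?I"
    using A B by (auto simp: frob_def intro!: L2_set_mono norm_triangle_ineq)
  also have "\<dots> \<le> frob A + frob B"
    using L2_set_triangle_ineq[of "\<lambda>p. cmod (A $$ p)" "\<lambda>p. cmod (B $$ p)" ?I] A B
    by (simp add: frob_def)
  finally show ?thesis .
qed

lemma frob_minus_commute:
  assumes "A \<in> carrier_mat n n" "B \<in> carrier_mat n n"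
  shows "frob (A - B) = frob (B - A)"
  unfolding frob_def using assms by (intro L2_set_cong) (auto simp: norm_minus_commute)

lemma frob_minus:
  assumes A: "A \<in> carrier_mat n n" and B: "B \<in> carrier_mat n n"
  shows "frob (A - B) \<le> frob A + frob B"
proof -
  let ?I = "{..<n} \<times> {..<n}"
  have "frob (A - B) \<le> L2_set (\<lambda>p. cmod (A $$ p) + cmod (B $$ p)) ?I"
    using A B by (auto simp: frob_def intro!: L2_set_mono norm_triangle_ineq4)
  also have "\<dots> \<le> frob A + frob B"
    using L2_set_triangle_ineq[of "\<lambda>p. cmod (A $$ p)" "\<lambda>p. cmod (B $$ p)" ?I] A B
    by (simp add: frob_def)
  finally show ?thesis .
qed

lemma frob_double:
  assumes A: "A \<in> carrier_mat n n"
  shows "frob (A + A) = 2 * frob A"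
proof -
  have "frob (A + A) = L2_set (\<lambda>p. 2 * cmod (A $$ p)) ({..<n} \<times> {..<n})"
    unfolding frob_def using A
    by (intro L2_set_cong) (auto simp: norm_mult simp flip: mult_2)
  then show ?thesis using A by (simp add: L2_set_right_distrib frob_def)
qed

text \<open>Cauchy-Schwarz bounds each entry by a row norm times a column norm, and the sum of the
  squares of these products factors.\<close>

lemma frob_mult:
  assumes A: "A \<in> carrier_mat n n" and B: "B \<in> carrier_mat n n"
  shows "frob (A * B) \<le> frob A * frob B"
proof -
  define a where "a i = L2_set (\<lambda>k. cmod (A $$ (i, k))) {..<n}" for i
  define b where "b j = L2_set (\<lambda>k. cmod (B $$ (k, j))) {..<n}" for j
  have entry: "cmod ((A * B) $$ (i, j)) \<le> a i * b j" if "i < n" "j < n" for i j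
  proof -
    have "(A * B) $$ (i, j) = (\<Sum>k<n. A $$ (i, k) * B $$ (k, j))"
      using A B that by (simp add: scalar_prod_def lessThan_atLeast0)
    then have "cmod ((A * B) $$ (i, j)) \<le> (\<Sum>k<n. cmod (A $$ (i, k)) * cmod (B $$ (k, j)))"
      by (auto simp: norm_mult intro: order_trans[OF norm_sum])
    also have "\<dots> \<le> a i * b j"
      using L2_set_mult_ineq[of "\<lambda>k. cmod (A $$ (i, k))" "\<lambda>k. cmod (B $$ (k, j))" "{..<n}"]
      by (simp add: a_def b_def)
    finally show ?thesis .
  qed
  have "(frob (A * B))\<^sup>2 = (\<Sum>i<n. \<Sum>j<n. (cmod ((A * B) $$ (i, j)))\<^sup>2)"
    by (rule frob_power2[OF mult_carrier_mat[OF A B]])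
  also have "\<dots> \<le> (\<Sum>i<n. \<Sum>j<n. (a i * b j)\<^sup>2)"
    using entry by (intro sum_mono power_mono) auto
  also have "\<dots> = (\<Sum>i<n. (a i)\<^sup>2) * (\<Sum>j<n. (b j)\<^sup>2)"
    by (simp add: sum_product power_mult_distrib)
  also have "(\<Sum>i<n. (a i)\<^sup>2) = (frob A)\<^sup>2"
    by (simp add: frob_power2[OF A] a_def L2_set_def sum_nonneg)
  also have "(\<Sum>j<n. (b j)\<^sup>2) = (frob B)\<^sup>2"
    unfolding frob_power2[OF B] by (subst sum.swap) (simp add: b_def L2_set_def sum_nonneg)
  finally have "(frob (A * B))\<^sup>2 \<le> (frob A * frob B)\<^sup>2"
    by (simp add: power_mult_distrib)
  then show ?thesis
    by (rule power2_le_imp_le) (simp add: frob_nonneg)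
qed

lemma frob_mat_adjoint:
  assumes A: "A \<in> carrier_mat n n"
  shows "frob (mat_adjoint A) = frob A"
proof -
  have "(frob (mat_adjoint A))\<^sup>2 = (\<Sum>i<n. \<Sum>j<n. (cmod (A $$ (j, i)))\<^sup>2)"
    unfolding frob_power2[OF mat_adjoint_square_carrier[OF A]]
    by (simp add: mat_adjoint_index[OF A])
  also have "\<dots> = (frob A)\<^sup>2"
    unfolding frob_power2[OF A] by (rule sum.swap)
  finally show ?thesis
    by (simp add: power2_eq_iff_nonneg frob_nonneg)
qed

text \<open>The right side is the trace of \<open>mat_adjoint A * A\<close>, in which a unitary left
  factor of \<open>A\<close> cancels.\<close>

lemma frob_power2_trace:
  assumes A: "A \<in> carrier_mat n n"
  shows "complex_of_real ((frob A)\<^sup>2) = (\<Sum>j<n. (mat_adjoint A * A) $$ (j, j))"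
proof -
  have "(mat_adjoint A * A) $$ (j, j) = (\<Sum>i<n. complex_of_real ((cmod (A $$ (i, j)))\<^sup>2))"
    if "j < n" for j
    using A that mat_adjoint_square_carrier[OF A]
    by (simp add: scalar_prod_def lessThan_atLeast0 mat_adjoint_index[OF A]
        complex_norm_square mult.commute del: of_real_power)
  then show ?thesis
    unfolding frob_power2[OF A] by (subst sum.swap) simp
qed

lemma frob_unitary_left:
  assumes U: "U \<in> carrier (unitary_group n)" and A: "A \<in> carrier_mat n n"
  shows "frob (U * A) = frob A"
proof -
  have Uc: "U \<in> carrier_mat n n" and UU: "mat_adjoint U * U = 1\<^sub>m n"
    using U by (auto simp: unitary_group_def)
  note C = mat_adjoint_square_carrier[OF Uc] mat_adjoint_square_carrier[OF A]
  have "mat_adjoint (U * A) * (U * A) = mat_adjoint A * ((mat_adjoint U * U) * A)"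
    unfolding mat_adjoint_mult[OF Uc A] using Uc A C by (simp add: assoc_mult_mat[of _ n n _ n _ n])
  also have "\<dots> = mat_adjoint A * A" using A by (simp add: UU)
  finally have "complex_of_real ((frob (U * A))\<^sup>2) = complex_of_real ((frob A)\<^sup>2)"
    unfolding frob_power2_trace[OF A] frob_power2_trace[OF mult_carrier_mat[OF Uc A]] by simp
  then have "(frob (U * A))\<^sup>2 = (frob A)\<^sup>2" by (simp only: of_real_eq_iff)
  then show ?thesis by (simp add: power2_eq_iff_nonneg frob_nonneg)
qed

lemma unitary_carrier_mat: "U \<in> carrier (unitary_group n) \<Longrightarrow> U \<in> carrier_mat n n"
  by (simp add: unitary_group_def)

lemma unitary_mat_adjoint:
  "U \<in> carrier (unitary_group n) \<Longrightarrow> mat_adjoint U \<in> carrier (unitary_group n)"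
  by (auto simp: unitary_group_def mat_adjoint_square_carrier mat_adjoint_adjoint)

lemma frob_unitary_right:
  assumes U: "U \<in> carrier (unitary_group n)" and A: "A \<in> carrier_mat n n"
  shows "frob (A * U) = frob A"
proof -
  note Uc = unitary_carrier_mat[OF U]
  have "frob (A * U) = frob (mat_adjoint U * mat_adjoint A)"
    using frob_mat_adjoint[OF mult_carrier_mat[OF A Uc]] by (simp add: mat_adjoint_mult[OF A Uc])
  also have "\<dots> = frob A"
    by (simp add: frob_unitary_left[OF unitary_mat_adjoint[OF U]] mat_adjoint_square_carrier[OF A]
        frob_mat_adjoint[OF A])
  finally show ?thesis .
qed

text \<open>Only the additive structure is left after distributing products, so comparing entries with
  the products kept atomic decides identities between noncommutative polynomials.\<close>
lemmas mat_distribs = mult_minus_distrib_mat[of _ n n _ n] minus_mult_distrib_mat[of _ n n _ _ n]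
  mult_add_distrib_mat[of _ n n _ n] add_mult_distrib_mat[of _ n n _ _ n]
  assoc_mult_mat[of _ n n _ n _ n] minus_carrier_mat[of _ n n] for n

section \<open>Distance to the identity on unitary matrices\<close>

lemma frob_mult_minus_one:
  assumes A: "A \<in> carrier (unitary_group n)" and B: "B \<in> carrier (unitary_group n)"
  shows "frob (A * B - 1\<^sub>m n) \<le> frob (A - 1\<^sub>m n) + frob (B - 1\<^sub>m n)"
proof -
  note C = unitary_carrier_mat[OF A] unitary_carrier_mat[OF B]
  have "A * B - 1\<^sub>m n = (A - 1\<^sub>m n) + A * (B - 1\<^sub>m n)"
    using C by (intro eq_matI) (simp_all add: mat_distribs[where n = n] del: index_mult_mat(1))
  also have "frob \<dots> \<le> frob (A - 1\<^sub>m n) + frob (A * (B - 1\<^sub>m n))"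
    using C by (intro frob_add[of _ n]) auto
  also have "frob (A * (B - 1\<^sub>m n)) = frob (B - 1\<^sub>m n)"
    using C by (intro frob_unitary_left[OF A]) auto
  finally show ?thesis .
qed

lemma frob_adjoint_mult_minus_one:
  assumes A: "A \<in> carrier (unitary_group n)" and B: "B \<in> carrier_mat n n"
  shows "frob (mat_adjoint A * B - 1\<^sub>m n) = frob (B - A)"
proof -
  have "mat_adjoint A * (B - A) = mat_adjoint A * B - 1\<^sub>m n"
    using A B mat_adjoint_square_carrier[of A n]
    by (simp add: unitary_group_def mat_distribs[where n = n])
  then show ?thesis
    using frob_unitary_left[OF unitary_mat_adjoint[OF A], of "B - A"] B unitary_carrier_mat[OF A]
    by (simp add: minus_carrier_mat)
qed

lemma frob_conj_minus_one:
  assumes A: "A \<in> carrier (unitary_group n)" and B: "B \<in> carrier (unitary_group n)"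
  shows "frob (B * A * mat_adjoint B - 1\<^sub>m n) = frob (A - 1\<^sub>m n)"
proof -
  note C = unitary_carrier_mat[OF A] unitary_carrier_mat[OF B]
  have "B * (A - 1\<^sub>m n) * mat_adjoint B = B * A * mat_adjoint B - 1\<^sub>m n"
    using B C mat_adjoint_square_carrier[OF C(2)]
    by (auto simp: unitary_group_def mat_distribs[where n = n])
  moreover have "A - 1\<^sub>m n \<in> carrier_mat n n" using C by auto
  ultimately show ?thesis
    using frob_unitary_right[OF unitary_mat_adjoint[OF B], of "B * (A - 1\<^sub>m n)"]
      frob_unitary_left[OF B, of "A - 1\<^sub>m n"] C by simp
qed

text \<open>Up to a unitary right factor the difference is \<open>A * B - B * A\<close>, which
  equals \<open>X * Y - Y * X\<close> for \<open>X = A - 1\<close> and \<open>Y = B - 1\<close>;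
  each product is bounded by submultiplicativity.\<close>

lemma frob_commutator_minus_one:
  assumes A: "A \<in> carrier (unitary_group n)" and B: "B \<in> carrier (unitary_group n)"
  shows "frob (A * B * mat_adjoint A * mat_adjoint B - 1\<^sub>m n) \<le>
    2 * frob (A - 1\<^sub>m n) * frob (B - 1\<^sub>m n)"
proof -
  note C = unitary_carrier_mat[OF A] unitary_carrier_mat[OF B]
    unitary_carrier_mat[OF unitary_mat_adjoint[OF A]]
    unitary_carrier_mat[OF unitary_mat_adjoint[OF B]]
  define X Y where "X = A - 1\<^sub>m n" and "Y = B - 1\<^sub>m n"
  have XY: "X \<in> carrier_mat n n" "Y \<in> carrier_mat n n" using C by (auto simp: X_def Y_def)
  have AA: "B * (A * (mat_adjoint A * mat_adjoint B)) = 1\<^sub>m n"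
  proof -
    have "A * (mat_adjoint A * mat_adjoint B) = mat_adjoint B"
      using A C by (simp add: unitary_group_def flip: assoc_mult_mat[of _ n n _ n _ n])
    then show ?thesis using B by (simp add: unitary_group_def)
  qed
  have eq: "(A * B - B * A) * (mat_adjoint A * mat_adjoint B) =
      A * B * mat_adjoint A * mat_adjoint B - 1\<^sub>m n"
    using C by (simp add: mat_distribs[where n = n] AA)
  have "mat_adjoint A * mat_adjoint B \<in> carrier (unitary_group n)"
    using monoid.m_closed[OF group.is_monoid[OF group_unitary_group[of n]]
        unitary_mat_adjoint[OF A] unitary_mat_adjoint[OF B]]
    by (simp add: unitary_group_def)
  moreover have "A * B - B * A \<in> carrier_mat n n" using C by (simp add: minus_carrier_mat)
  ultimately have "frob (A * B * mat_adjoint A * mat_adjoint B - 1\<^sub>m n) = frob (A * B - B * A)"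
    using frob_unitary_right eq by metis
  also have "A * B - B * A = X * Y - Y * X"
    using C by (intro eq_matI) (simp_all add: X_def Y_def mat_distribs[where n = n] del: index_mult_mat(1))
  also have "frob \<dots> \<le> frob (X * Y) + frob (Y * X)"
    using XY by (intro frob_minus[of _ n]) auto
  also have "\<dots> \<le> 2 * frob X * frob Y"
    using frob_mult[OF XY] frob_mult[OF XY(2,1)] by (simp add: mult.commute[of "frob Y"])
  finally show ?thesis by (simp add: X_def Y_def)
qed

lemma frob_square_minus_one:
  assumes A: "A \<in> carrier_mat n n"
  shows "(2 - frob (A - 1\<^sub>m n)) * frob (A - 1\<^sub>m n) \<le> frob (A * A - 1\<^sub>m n)"
proof -
  define X where "X = A - 1\<^sub>m n"
  have X: "X \<in> carrier_mat n n" using A by (auto simp: X_def)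
  have "X + X = (A * A - 1\<^sub>m n) - X * X"
    using A by (intro eq_matI) (simp_all add: X_def mat_distribs[where n = n] del: index_mult_mat(1))
  then have "2 * frob X \<le> frob (A * A - 1\<^sub>m n) + frob (X * X)"
    using frob_minus[of "A * A - 1\<^sub>m n" n "X * X"] frob_double[OF X] A X
    by (auto simp: minus_carrier_mat)
  also have "frob (X * X) \<le> frob X * frob X" by (rule frob_mult[OF X X])
  finally show ?thesis by (simp add: X_def algebra_simps)
qed

text \<open>All entries of a unitary matrix lie in one disc. A cell records a nearby point of a
  finite net of that disc for each entry.\<close>

lemma unitary_totally_bounded:
  assumes "0 < \<epsilon>"
  shows "\<exists>cell :: complex mat \<Rightarrow> nat. finite (cell ` carrier (unitary_group n)) \<and>
    (\<forall>A\<in>carrier (unitary_group n). \<forall>B\<in>carrier (unitary_group n).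
      cell A = cell B \<longrightarrow> frob (mat_adjoint A * B - 1\<^sub>m n) \<le> \<epsilon>)"
proof -
  let ?U = "carrier (unitary_group n)" and ?I = "{..<n} \<times> {..<n}"
  \<comment> \<open>Entries in a common cell differ by at most \<open>2 * \<eta>\<close>, so the
    norm is at most \<open>n * n\<close> times this. The \<open>+ 1\<close> avoids a zero
    denominator at \<open>n = 0\<close>.\<close>
  define \<eta> where "\<eta> = \<epsilon> / (2 * real (n * n) + 1)"
  define K where "K = frob (1\<^sub>m n)"
  have \<eta>: "0 < \<eta>" using assms by (simp add: \<eta>_def add_nonneg_pos)
  have "\<exists>net. finite net \<and> cball (0::complex) K \<subseteq> (\<Union>x\<in>net. ball x \<eta>)"
    using compact_cball[of "0::complex" K] \<eta> by (simp add: compact_eq_totally_bounded)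
  then obtain net where net: "finite net" "cball (0::complex) K \<subseteq> (\<Union>x\<in>net. ball x \<eta>)"
    by blast
  have "\<exists>x\<in>net. dist x z < \<eta>" if "z \<in> cball 0 K" for z
  proof -
    have "z \<in> (\<Union>x\<in>net. ball x \<eta>)" using net(2) that by blast
    then show ?thesis by (simp only: UN_iff mem_ball)
  qed
  then obtain near where near: "\<And>z. z \<in> cball 0 K \<Longrightarrow> near z \<in> net \<and> dist (near z) z < \<eta>"
    by metis
  have entry: "A $$ (i, j) \<in> cball 0 K" if A: "A \<in> ?U" and "i < n" "j < n" for A i j
  proof -
    have "frob A = K"
      using frob_unitary_left[OF A, of "1\<^sub>m n"] unitary_carrier_mat[OF A] by (simp add: K_def)
    then show ?thesis using cmod_index_le_frob[OF unitary_carrier_mat[OF A]] that by auto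
  qed
  define profile where "profile A = restrict (\<lambda>p. near (A $$ p)) ?I" for A
  have "profile A \<in> ?I \<rightarrow>\<^sub>E net" if "A \<in> ?U" for A
    unfolding profile_def using entry[OF that] near by (intro restrict_PiE_iff[THEN iffD2]) auto
  then have "profile ` ?U \<subseteq> ?I \<rightarrow>\<^sub>E net" by blast
  moreover have "finite (?I \<rightarrow>\<^sub>E net)" using net(1) by (intro finite_PiE) auto
  ultimately have fin: "finite (profile ` ?U)" by (rule finite_subset)
  \<comment> \<open>The finitely many profiles are numbered, as cells are natural numbers.\<close>
  obtain h :: "(nat \<times> nat \<Rightarrow> complex) \<Rightarrow> nat" where h: "inj_on h (profile ` ?U)"
    using finite_imp_inj_to_nat_seg[OF fin] by blast
  have "frob (mat_adjoint A * B - 1\<^sub>m n) \<le> \<epsilon>"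
    if A: "A \<in> ?U" and B: "B \<in> ?U" and eq: "h (profile A) = h (profile B)" for A B
  proof -
    have prof: "profile A = profile B" using h A B eq by (auto dest: inj_onD)
    have "cmod ((B - A) $$ (i, j)) \<le> 2 * \<eta>" if ij: "i < n" "j < n" for i j
    proof -
      have "near (A $$ (i, j)) = near (B $$ (i, j))"
        using fun_cong[OF prof, of "(i, j)"] ij by (simp add: profile_def)
      then have "dist (B $$ (i, j)) (A $$ (i, j)) \<le> 2 * \<eta>"
        using near[OF entry[OF A ij]] near[OF entry[OF B ij]]
          dist_triangle3[of "B $$ (i, j)" "A $$ (i, j)" "near (A $$ (i, j))"] by simp
      then show ?thesis
        using ij unitary_carrier_mat[OF A] unitary_carrier_mat[OF B] by (simp add: dist_norm)
    qed
    then have "frob (B - A) \<le> real (n * n) * (2 * \<eta>)"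
      using unitary_carrier_mat[OF A] unitary_carrier_mat[OF B] by (intro frob_le) auto
    also have "\<dots> = \<epsilon> * (2 * real (n * n) / (2 * real (n * n) + 1))" by (simp add: \<eta>_def)
    also have "\<dots> \<le> \<epsilon> * 1"
      using assms by (intro mult_left_mono) (auto simp: divide_le_eq_1 add_nonneg_pos)
    finally show ?thesis
      using frob_adjoint_mult_minus_one[OF A unitary_carrier_mat[OF B]] by simp
  qed
  then show ?thesis
    using finite_imageI[OF fin, of h] by (intro exI[of _ "h \<circ> profile"]) (simp add: image_comp)
qed

section \<open>Linear algebra bounding the length of centralizer chains\<close>

interpretation fun_vs: vector_space "\<lambda>(c::complex) f (x :: nat \<times> nat). c * f x"
  by unfold_locales (auto simp: fun_eq_iff algebra_simps)

lemma sum_fun_apply: "(\<Sum>i\<in>I. f i) x = (\<Sum>i\<in>I. f i x :: 'b :: comm_monoid_add)"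
  by (induction I rule: infinite_finite_induct) auto

text \<open>If \<open>g i\<close> commutes with \<open>h j\<close> for \<open>j < i\<close> but not for \<open>j = i\<close>, then the \<open>g i\<close> are linearly
  independent: everything in the span of \<open>g (k + 1), \<dots>, g (m - 1)\<close> commutes with \<open>h k\<close>.\<close>
lemma commuting_staircase_length_le:
  fixes g h :: "nat \<Rightarrow> complex mat"
  assumes carr: "\<And>i. i < m \<Longrightarrow> g i \<in> carrier_mat n n" "\<And>i. i < m \<Longrightarrow> h i \<in> carrier_mat n n"
    and comm: "\<And>i j. i < m \<Longrightarrow> j < i \<Longrightarrow> g i * h j = h j * g i"
    and ncomm: "\<And>i. i < m \<Longrightarrow> g i * h i \<noteq> h i * g i"
  shows "m \<le> n * n"
proof -
  let ?I = "{..<n} \<times> {..<n}"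
  define v where "v i p = (if p \<in> ?I then g i $$ p else 0)" for i p
  define \<delta> where "\<delta> p q = (if q = p then 1 else (0::complex))" for p q :: "nat \<times> nat"
  \<comment> \<open>Commutation with \<open>h k\<close> is spelled out entrywise so that it makes
    sense for arbitrary functions and visibly defines a linear subspace.\<close>
  define C where "C k = {f :: nat \<times> nat \<Rightarrow> complex. \<forall>i<n. \<forall>j<n.
      (\<Sum>l<n. f (i, l) * h k $$ (l, j)) = (\<Sum>l<n. h k $$ (i, l) * f (l, j))}" for k
  have v_C: "v i \<in> C k \<longleftrightarrow> g i * h k = h k * g i" if "i < m" "k < m" for i k
  proof -
    have "g i * h k = h k * g i \<longleftrightarrow>
        (\<forall>a<n. \<forall>b<n. (g i * h k) $$ (a, b) = (h k * g i) $$ (a, b))"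
      using carr(1)[OF that(1)] carr(2)[OF that(2)]
      by (auto intro!: eq_matI simp del: index_mult_mat(1))
    also have "\<dots> \<longleftrightarrow> v i \<in> C k"
      using carr(1)[OF that(1)] carr(2)[OF that(2)]
      by (simp add: C_def v_def scalar_prod_def lessThan_atLeast0)
    finally show ?thesis by simp
  qed
  have C_subspace: "fun_vs.subspace (C k)" for k
    unfolding fun_vs.subspace_def
    by (auto simp: C_def distrib_right distrib_left sum.distrib mult.assoc mult.left_commute
        simp flip: sum_distrib_left)
  \<comment> \<open>Downward induction, as \<open>C k\<close> separates \<open>v k\<close> from all
    later vectors. The cardinality clause records that the vectors are distinct, so that the
    dimension bound counts indices.\<close>
  have indep: "fun_vs.independent (v ` {k..<m}) \<and> card (v ` {k..<m}) = m - k" if "k \<le> m" for k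
    using that
  proof (induction k rule: inc_induct)
    case base
    show ?case by (simp add: fun_vs.independent_empty)
  next
    case (step k)
    have "v ` {Suc k..<m} \<subseteq> C k" using v_C comm step.hyps by auto
    then have "fun_vs.span (v ` {Suc k..<m}) \<subseteq> C k"
      using C_subspace by (intro fun_vs.span_minimal)
    moreover have "v k \<notin> C k" using v_C ncomm step.hyps by auto
    ultimately have notin: "v k \<notin> fun_vs.span (v ` {Suc k..<m})" by blast
    then have "v k \<notin> v ` {Suc k..<m}" using fun_vs.span_base by blast
    moreover have "{k..<m} = insert k {Suc k..<m}" using step.hyps by auto
    ultimately show ?case
      using fun_vs.independent_insertI[OF notin] step by simp
  qed
  have "v ` {0..<m} \<subseteq> fun_vs.span (\<delta> ` ?I)"
  proof clarify
    fix i
    have "v i = (\<Sum>p\<in>?I. (\<lambda>q. v i p * \<delta> p q))"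
      by (auto simp: fun_eq_iff sum_fun_apply \<delta>_def v_def if_distrib[of "\<lambda>x. _ * x"] cong: if_cong)
    also have "\<dots> \<in> fun_vs.span (\<delta> ` ?I)"
      by (intro fun_vs.span_sum fun_vs.span_scale fun_vs.span_base) auto
    finally show "v i \<in> fun_vs.span (\<delta> ` ?I)" .
  qed
  then have "card (v ` {0..<m}) \<le> card (\<delta> ` ?I)"
    using fun_vs.independent_span_bound[of "\<delta> ` ?I" "v ` {0..<m}"] indep[of 0] by simp
  also have "\<dots> \<le> card ?I" by (rule card_image_le) simp
  finally show ?thesis using indep[of 0] by (simp add: card_cartesian_product)
qed

text \<open>Strictness at step \<open>i\<close> yields a \<open>g\<close> commuting with all earlier
  entries but not with \<open>hs ! i\<close>, which is the staircase configuration.\<close>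

lemma unitary_centralizer_chain_length:
  assumes H: "H \<subseteq> carrier (unitary_group n)"
    and chain: "centralizer_chain ((unitary_group n)\<lparr>carrier := H\<rparr>) hs"
  shows "length hs \<le> n * n"
proof -
  let ?K = "(unitary_group n)\<lparr>carrier := H\<rparr>"
  have mult: "x \<otimes>\<^bsub>unitary_group n\<^esub> y = x * y" for x y by (simp add: unitary_group_def)
  have "\<exists>g\<in>H. (\<forall>j<i. g * hs ! j = hs ! j * g) \<and> g * hs ! i \<noteq> hs ! i * g"
    if i: "i < length hs" for i
  proof -
    have "centralizer ?K (set (take (Suc i) hs)) \<subset> centralizer ?K (set (take i hs))"
      using chain i centralizer_antimono[of "set (take i hs)" "set (take (Suc i) hs)" ?K]
        set_take_subset_set_take[of i "Suc i" hs]
      by (auto simp: centralizer_chain_def)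
    then obtain g where "g \<in> centralizer ?K (set (take i hs))"
        "g \<notin> centralizer ?K (set (take (Suc i) hs))"
      by blast
    moreover have "hs ! j \<in> set (take i hs)" if "j < i" for j
      using nth_mem[of j "take i hs"] that i by simp
    ultimately show ?thesis
      using i by (intro bexI[of _ g]) (simp_all add: centralizer_def mult take_Suc_conv_app_nth)
  qed
  then obtain g where g: "\<And>i. i < length hs \<Longrightarrow> g i \<in> H"
      "\<And>i j. i < length hs \<Longrightarrow> j < i \<Longrightarrow> g i * hs ! j = hs ! j * g i"
      "\<And>i. i < length hs \<Longrightarrow> g i * hs ! i \<noteq> hs ! i * g i"
    by metis
  have "hs ! i \<in> H" if "i < length hs" for i
    using chain that nth_mem[OF that] by (auto simp: centralizer_chain_def)
  then show ?thesis
    using g H unitary_carrier_mat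
    by (intro commuting_staircase_length_le[of "length hs" g n "\<lambda>i. hs ! i"]) blast+
qed

section \<open>Application to groups generated by unitary matrices\<close>

text \<open>Arbitrary subgroups are allowed because the growth bound is applied inside the generated
  group itself.\<close>

lemma commutator_contracting_unitary_subgroup:
  assumes H: "subgroup H (unitary_group n)"
  shows "commutator_contracting_group ((unitary_group n)\<lparr>carrier := H\<rparr>)
    (\<lambda>A. frob (A - 1\<^sub>m n)) (n * n)"
proof -
  let ?U = "unitary_group n" and ?K = "(unitary_group n)\<lparr>carrier := H\<rparr>"
  interpret U: group ?U by (rule group_unitary_group)
  interpret K: group ?K by (rule U.subgroup_imp_group[OF H])
  have HU: "A \<in> carrier ?U" if "A \<in> H" for A using subgroup.subset[OF H] that by blast
  have Hc: "A \<in> carrier_mat n n" if "A \<in> H" for A using HU[OF that] by (rule unitary_carrier_mat)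
  have ops: "x \<otimes>\<^bsub>?K\<^esub> y = x * y" "\<one>\<^bsub>?K\<^esub> = 1\<^sub>m n" "carrier ?K = H" for x y
    by (simp_all add: unitary_group_def)
  have inv: "inv\<^bsub>?K\<^esub> A = mat_adjoint A" if "A \<in> H" for A
    using U.m_inv_consistent[OF H that] inv_unitary_group[OF HU[OF that]] by simp
  show ?thesis
  proof (unfold_locales, unfold ops)
    fix A assume A: "A \<in> H"
    show "0 \<le> frob (A - 1\<^sub>m n)" by (rule frob_nonneg)
    have "A - 1\<^sub>m n = 0\<^sub>m n n \<longleftrightarrow> A = 1\<^sub>m n"
    proof
      assume 0: "A - 1\<^sub>m n = 0\<^sub>m n n"
      show "A = 1\<^sub>m n"
      proof (rule eq_matI)
        fix i j assume ij: "i < dim_row (1\<^sub>m n)" "j < dim_col (1\<^sub>m n)"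
        have "(A - 1\<^sub>m n) $$ (i, j) = 0" unfolding 0 using ij by simp
        then show "A $$ (i, j) = 1\<^sub>m n $$ (i, j)" using ij Hc[OF A] by simp
      qed (use Hc[OF A] in auto)
    qed (auto intro!: eq_matI)
    then show "frob (A - 1\<^sub>m n) = 0 \<longleftrightarrow> A = 1\<^sub>m n"
      using frob_eq_0_iff[of "A - 1\<^sub>m n" n] Hc[OF A] by (simp add: minus_carrier_mat)
    have "frob (mat_adjoint A * 1\<^sub>m n - 1\<^sub>m n) = frob (1\<^sub>m n - A)"
      by (rule frob_adjoint_mult_minus_one[OF HU[OF A] one_carrier_mat])
    then show "frob (inv\<^bsub>?K\<^esub> A - 1\<^sub>m n) = frob (A - 1\<^sub>m n)"
      using Hc[OF A] mat_adjoint_square_carrier[OF Hc[OF A]]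
      by (simp add: inv[OF A] frob_minus_commute[of A n "1\<^sub>m n"])
    show "(2 - frob (A - 1\<^sub>m n)) * frob (A - 1\<^sub>m n) \<le> frob (A * A - 1\<^sub>m n)"
      by (rule frob_square_minus_one[OF Hc[OF A]])
    fix B assume B: "B \<in> H"
    show "frob (A * B - 1\<^sub>m n) \<le> frob (A - 1\<^sub>m n) + frob (B - 1\<^sub>m n)"
      by (rule frob_mult_minus_one[OF HU[OF A] HU[OF B]])
    show "frob (B * A * inv\<^bsub>?K\<^esub> B - 1\<^sub>m n) = frob (A - 1\<^sub>m n)"
      unfolding inv[OF B] by (rule frob_conj_minus_one[OF HU[OF A] HU[OF B]])
    show "frob (commutator ?K A B - 1\<^sub>m n) \<le> 2 * frob (A - 1\<^sub>m n) * frob (B - 1\<^sub>m n)"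
      unfolding commutator_def ops inv[OF A] inv[OF B]
      by (rule frob_commutator_minus_one[OF HU[OF A] HU[OF B]])
  next
    fix \<epsilon> :: real assume "0 < \<epsilon>"
    then obtain cell :: "complex mat \<Rightarrow> nat" where cell: "finite (cell ` carrier ?U)"
        "\<And>A B. A \<in> carrier ?U \<Longrightarrow> B \<in> carrier ?U \<Longrightarrow> cell A = cell B \<Longrightarrow>
          frob (mat_adjoint A * B - 1\<^sub>m n) \<le> \<epsilon>"
      using unitary_totally_bounded[of \<epsilon> n] by blast
    have "finite (cell ` H)"
      using cell(1) HU by (meson finite_subset image_mono subsetI)
    then show "\<exists>cell :: complex mat \<Rightarrow> nat. finite (cell ` H) \<and>
        (\<forall>A\<in>H. \<forall>B\<in>H. cell A = cell B \<longrightarrow> frob (inv\<^bsub>?K\<^esub> A * B - 1\<^sub>m n) \<le> \<epsilon>)"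
      using cell(2) HU inv by (intro exI[of _ cell]) auto
  next
    fix hs assume "centralizer_chain ?K hs"
    then show "length hs \<le> n * n"
      using subgroup.subset[OF H] by (rule unitary_centralizer_chain_length[rotated])
  qed
qed

theorem proposition5p2:
  shows "\<forall>n\<ge>1. \<exists>\<alpha>::real. \<alpha> > 0 \<and>
    (\<forall>\<Sigma>. finite \<Sigma> \<and> symmetric_subset (unitary_group n) \<Sigma> \<and>
        \<not> virtually_abelian ((unitary_group n)\<lparr>carrier := generate (unitary_group n) \<Sigma>\<rparr>) \<longrightarrow>
      (\<exists>c::real. c > 0 \<and>
        (\<forall>r::nat. r \<ge> 1 \<longrightarrow>
          real (card (product_set (unitary_group n) \<Sigma> r)) \<ge> 2 powr (c * real r powr \<alpha>))))"
proof (intro allI impI)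
  fix n :: nat
  \<comment> \<open>The exponent of \<open>growth_lower_bound\<close> for \<open>D = n * n\<close>;
    it depends on \<open>n\<close> alone.\<close>
  define \<alpha> :: real where "\<alpha> = log (2 ^ (n * n + 5)) (1 + 1 / (2 * 2 ^ (n * n)))"
  have "(1::real) < 2 ^ (n * n + 5)" by (rule one_less_power) auto
  then have \<alpha>: "0 < \<alpha>" unfolding \<alpha>_def 
    by (subst zero_less_log_cancel_iff) (auto intro: add_pos_pos)
  have "\<exists>c>0. \<forall>r\<ge>1. 2 powr (c * real r powr \<alpha>) \<le> real (card (product_set (unitary_group n) \<Sigma> r))"
    if fin: "finite \<Sigma>" and sym: "symmetric_subset (unitary_group n) \<Sigma>"
      and nva: "\<not> virtually_abelian ((unitary_group n)\<lparr>carrier := generate (unitary_group n) \<Sigma>\<rparr>)"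
    for \<Sigma>
  proof -
    let ?U = "unitary_group n"
    let ?H = "generate ?U \<Sigma>"
    let ?K = "?U\<lparr>carrier := ?H\<rparr>"
    interpret U: group ?U by (rule group_unitary_group)
    have \<Sigma>: "\<Sigma> \<subseteq> carrier ?U" using sym by (simp add: symmetric_subset_def)
    have H: "subgroup ?H ?U" by (rule U.generate_is_subgroup[OF \<Sigma>])
    interpret K: commutator_contracting_group ?K "\<lambda>A. frob (A - 1\<^sub>m n)" "n * n"
      by (rule commutator_contracting_unitary_subgroup[OF H])
    \<comment> \<open>Product sets involve only the multiplication and the unit, not the carrier.
      They therefore also serve to show that \<open>\<Sigma>\<close> generates \<open>?K\<close>
      within \<open>?K\<close>.\<close>
    have prod: "product_set ?K \<Sigma> r = product_set ?U \<Sigma> r" for r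
      by (induction r) (simp_all add: set_mult_def)
    have \<Sigma>H: "\<Sigma> \<subseteq> ?H" by (auto intro: generate.incl)
    then have symK: "symmetric_subset ?K \<Sigma>"
      using sym U.m_inv_consistent[OF H] by (auto simp: symmetric_subset_def)
    have "carrier ?K = (\<Union>r. product_set ?U \<Sigma> r)"
      using U.generate_eq_Union_product_set[OF sym] by simp
    also have "\<dots> = (\<Union>r. product_set ?K \<Sigma> r)" by (simp only: prod)
    also have "\<dots> = generate ?K \<Sigma>" by (rule K.generate_eq_Union_product_set[OF symK, symmetric])
    finally have "carrier ?K = generate ?K \<Sigma>" .
    then obtain c :: real where "0 < c"
        "\<And>r. 1 \<le> r \<Longrightarrow> 2 powr (c * real r powr \<alpha>) \<le> card (product_set ?K \<Sigma> r)"
      using K.growth_lower_bound[OF symK fin _ nva] unfolding \<alpha>_def by blast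
    then show ?thesis by (auto simp: prod)
  qed
  then show "\<exists>\<alpha>::real. \<alpha> > 0 \<and>
    (\<forall>\<Sigma>. finite \<Sigma> \<and> symmetric_subset (unitary_group n) \<Sigma> \<and>
        \<not> virtually_abelian ((unitary_group n)\<lparr>carrier := generate (unitary_group n) \<Sigma>\<rparr>) \<longrightarrow>
      (\<exists>c::real. c > 0 \<and>
        (\<forall>r::nat. r \<ge> 1 \<longrightarrow>
          real (card (product_set (unitary_group n) \<Sigma> r)) \<ge> 2 powr (c * real r powr \<alpha>))))"
    using \<alpha> by blast
qed

end
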